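(* Let $\mu_t\in M_t$, $t=0,\dots,T$, be probability measures and let $c$ and $\phi$ be nonnegative measurable functions on $S$. Assume that $\mu=\prod_{t=0}^T\mu_t$ and that $c$ and $\phi$ are $\mu$-integrable with $c\ge K\psi$ and $\phi\ge v$ for some $K\in\mathbb R$ and $v>1$. Consider \[ \text{(A)}\quad\text{minimize}\ \int_Sc\,d\lambda\ \text{ over }\lambda\in M_+\ \text{ subject to }\ \lambda\ll\mu,\ \frac{d\lambda}{d\mu}\le\phi,\ \lambda_t=\mu_t,\ t=0,\dots,T, \] \[ \text{(B)}\quad\text{minimize}\ \int_S\Big[\sum_{t=0}^Tx_t+\phi\Big[\sum_{t=0}^Tx_t+c\Big]^-\Big]d\mu\ \text{ over }x\in\prod_{t=0}^T\mathcal L^0_t . \] Then the optima in (A) and (B) are attained, there is no duality gap (i.e. $\inf(\mathrm B)=-\inf(\mathrm A)$), and feasible solutions $\lambda$ of (A) and $x$ of (B) are optimal if and only if, $\mu$-almost everywhere, \begin{align*} d\lambda/d\mu&=0\quad\text{if}\quad-\sum_{t=0}^Tx_t<c,\\ d\lambda/d\mu&\in[0,\phi]\quad\text{if}\quad-\sum_{t=0}^Tx_t=c,\\ d\lambda/d\mu&=\phi\quad\text{if}\quad-\sum_{t=0}^Tx_t>c . \end{align*} Moreover, if $x$ is feasible in (B), then $x_t\in\mathcal L^1_t$ for each $t$.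
   Context: $S_0,\dots,S_T$ are Polish spaces, $S=S_0\times\cdots\times S_T$, $\psi_t:S_t\to[1,\infty)$ are given continuous functions, $\psi(s)=\sum_{t=0}^T\psi_t(s_t)$. $M_t$ (resp. $M$) is the space of finite signed Borel measures on $S_t$ (resp. $S$) under which $\psi_t$ (resp. $\psi$) is integrable, and $M_+$ is the set of nonnegative elements of $M$. $\lambda_t$ is the $t$-th marginal of $\lambda$. $\mathcal L^0_t$ (resp. $\mathcal L^1_t$) is the space of real Borel measurable (resp. $\mu_t$-integrable) functions on $S_t$; $x_t$ is identified with $s\mapsto x_t(s_t)$ on $S$; $a^-=\max\{-a,0\}$. Integrals of functions are $+\infty$ unless the positive part is integrable. "Feasible" means satisfying the constraints with objective value less than $+\infty$. *)

theory Defs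
  imports "HOL-Probability.Probability"
begin

text \<open>
  The spaces \<open>S\<^sub>0, \<dots>, S\<^sub>T\<close> may all be different, and \<open>T\<close> is arbitrary. They are modelled as a family
  of abstract topologies \<open>X t\<close>, \<open>t \<le> T\<close>, whose carriers \<open>topspace (X t)\<close> are arbitrary subsets of
  one ambient type. This loses no generality, since any family of spaces can be realised on
  subsets of a common type. Points of \<open>S\<close> are the extensional functions in
  \<open>\<Pi>\<^sub>E t\<in>{..T}. topspace (X t)\<close>.
\<close>

definition polish :: "'a topology \<Rightarrow> bool" where
  "polish X \<longleftrightarrow> separable_space X \<and> completely_metrizable_space X"

definition borel_of :: "'a topology \<Rightarrow> 'a measure" where
  "borel_of X = sigma (topspace X) {U. openin X U}"

abbreviation product_top :: "nat \<Rightarrow> (nat \<Rightarrow> 'a topology) \<Rightarrow> (nat \<Rightarrow> 'a) topology" where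
  "product_top T X \<equiv> product_topology X {..T}"

text \<open>
  The function \<open>s \<mapsto> \<Sum>\<^sub>t f\<^sub>t(s\<^sub>t)\<close> on \<open>S\<close>, used both for \<open>\<psi>\<close> and for \<open>\<Sum>\<^sub>t x\<^sub>t\<close>.
\<close>

definition coord_sum :: "nat \<Rightarrow> (nat \<Rightarrow> 'a \<Rightarrow> real) \<Rightarrow> (nat \<Rightarrow> 'a) \<Rightarrow> real" where
  "coord_sum T f s = (\<Sum>t\<le>T. f t (s t))"

text \<open>
  The nonnegative elements of the space of finite signed Borel measures on \<open>X\<close> that integrate
  the weight \<open>w\<close>; a nonnegative signed measure is just a finite measure.
\<close>

definition M_plus :: "'a topology \<Rightarrow> ('a \<Rightarrow> real) \<Rightarrow> 'a measure set" where
  "M_plus X w = {\<nu>. sets \<nu> = sets (borel_of X) \<and> finite_measure \<nu> \<and> integrable \<nu> w}"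

abbreviation L0 :: "'a topology \<Rightarrow> ('a \<Rightarrow> real) set" where
  "L0 X \<equiv> borel_measurable (borel_of X)"

abbreviation L1 :: "'a measure \<Rightarrow> ('a \<Rightarrow> real) set" where
  "L1 \<nu> \<equiv> {f. integrable \<nu> f}"

text \<open>
  Integral with values in \<open>[-\<infinity>, \<infinity>]\<close>: it is \<open>\<infinity>\<close> unless the positive part is integrable. Note
  that \<^const>\<open>ennreal\<close> maps negative reals to \<open>0\<close>, so the two terms are the integrals of the positive
  and the negative part.
\<close>

definition ext_integral :: "'a measure \<Rightarrow> ('a \<Rightarrow> real) \<Rightarrow> ereal" where
  "ext_integral \<nu> f =
     (if integrable \<nu> (\<lambda>s. max (f s) 0)
      then enn2ereal (\<integral>\<^sup>+ s. ennreal (f s) \<partial>\<nu>) - enn2ereal (\<integral>\<^sup>+ s. ennreal (- f s) \<partial>\<nu>)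
      else \<infinity>)"

definition neg_part :: "real \<Rightarrow> real" where
  "neg_part a = max (- a) 0"

text \<open>
  Minimisation of an extended real objective over a constraint set: feasibility includes that the
  objective value is less than \<open>\<infinity>\<close>.
\<close>

definition feasible :: "'b set \<Rightarrow> ('b \<Rightarrow> ereal) \<Rightarrow> 'b \<Rightarrow> bool" where
  "feasible C J z \<longleftrightarrow> z \<in> C \<and> J z < \<infinity>"

definition optimal :: "'b set \<Rightarrow> ('b \<Rightarrow> ereal) \<Rightarrow> 'b \<Rightarrow> bool" where
  "optimal C J z \<longleftrightarrow> feasible C J z \<and> J z = (INF z'\<in>C. J z')"

definition constr_A ::
  "nat \<Rightarrow> (nat \<Rightarrow> 'a topology) \<Rightarrow> (nat \<Rightarrow> 'a \<Rightarrow> real) \<Rightarrow> (nat \<Rightarrow> 'a measure) \<Rightarrow>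
   (nat \<Rightarrow> 'a) measure \<Rightarrow> ((nat \<Rightarrow> 'a) \<Rightarrow> real) \<Rightarrow> (nat \<Rightarrow> 'a) measure set" where
  "constr_A T X \<psi> m \<mu> \<phi> =
     {\<nu> \<in> M_plus (product_top T X) (coord_sum T \<psi>).
        absolutely_continuous \<mu> \<nu> \<and>
        (AE s in \<mu>. RN_deriv \<mu> \<nu> s \<le> ennreal (\<phi> s)) \<and>
        (\<forall>t\<le>T. distr \<nu> (borel_of (X t)) (\<lambda>s. s t) = m t)}"

definition obj_A :: "((nat \<Rightarrow> 'a) \<Rightarrow> real) \<Rightarrow> (nat \<Rightarrow> 'a) measure \<Rightarrow> ereal" where
  "obj_A c \<nu> = ext_integral \<nu> c"

definition constr_B :: "nat \<Rightarrow> (nat \<Rightarrow> 'a topology) \<Rightarrow> (nat \<Rightarrow> 'a \<Rightarrow> real) set" where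
  "constr_B T X = (\<Pi> t\<in>{..T}. L0 (X t))"

definition obj_B ::
  "nat \<Rightarrow> (nat \<Rightarrow> 'a) measure \<Rightarrow> ((nat \<Rightarrow> 'a) \<Rightarrow> real) \<Rightarrow> ((nat \<Rightarrow> 'a) \<Rightarrow> real) \<Rightarrow>
   (nat \<Rightarrow> 'a \<Rightarrow> real) \<Rightarrow> ereal" where
  "obj_B T \<mu> c \<phi> x =
     ext_integral \<mu> (\<lambda>s. coord_sum T x s + \<phi> s * neg_part (coord_sum T x s + c s))"

text \<open>
  \<open>S\<close> carries the Borel sets of the product topology, while the product measure \<^const>\<open>PiM\<close> lives
  on the product of the Borel sigma-algebras. For Polish factors the two coincide.
\<close>

lemma space_borel_of [simp]: "space (borel_of X) = topspace X"
  by (simp add: borel_of_def space_measure_of_conv)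

lemma sets_borel_of: "sets (borel_of X) = sigma_sets (topspace X) {U. openin X U}"
  unfolding borel_of_def by (rule sets_measure_of) (auto dest: openin_subset)

lemma openin_in_sets_borel_of: "openin X U \<Longrightarrow> U \<in> sets (borel_of X)"
  by (auto simp: sets_borel_of)

lemma polish_imp_second_countable:
  assumes "polish X"
  shows "second_countable X"
proof -
  from assms obtain M d where "Metric_space M d" and X: "X = Metric_space.mtopology M d"
    by (auto simp: polish_def completely_metrizable_space_def)
  interpret Metric_space M d by fact
  from assms obtain C where C: "countable C" "C \<subseteq> M" "mtopology closure_of C = M"
    by (auto simp: polish_def separable_space_def X)
  define B where "B = (\<lambda>(x, n). mball x (inverse (real (Suc n)))) ` (C \<times> (UNIV :: nat set))"
  have "countable B"
    unfolding B_def using C(1) by auto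
  moreover have "\<forall>V\<in>B. openin mtopology V"
    by (auto simp: B_def)
  moreover have "\<exists>V\<in>B. x \<in> V \<and> V \<subseteq> U" if U: "openin mtopology U" "x \<in> U" for U x
  proof -
    from U obtain r where r: "r > 0" "mball x r \<subseteq> U"
      by (auto simp: openin_mtopology)
    have x: "x \<in> M"
      using U openin_subset by fastforce
    obtain n where n: "inverse (real (Suc n)) < r / 2"
      using reals_Archimedean[of "r / 2"] r by auto
    have "inverse (real (Suc n)) > 0"
      by simp
    with x C(3) obtain y where y: "y \<in> C" "y \<in> mball x (inverse (real (Suc n)))"
      unfolding metric_closure_of by blast
    have "x \<in> mball y (inverse (real (Suc n)))"
      using y by (simp add: commute)
    moreover have "mball y (inverse (real (Suc n))) \<subseteq> mball x r"
    proof
      fix z assume "z \<in> mball y (inverse (real (Suc n)))"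
      with y n x triangle[of x y z] show "z \<in> mball x r"
        by auto
    qed
    ultimately show ?thesis
      using r y by (auto simp: B_def)
  qed
  ultimately show ?thesis
    unfolding second_countable_def X by blast
qed

lemma sets_borel_of_product_top:
  assumes "\<And>t. t \<le> T \<Longrightarrow> polish (X t)"
  shows "sets (borel_of (product_top T X)) = sets (PiM {..T} (\<lambda>t. borel_of (X t)))"
proof
  show "sets (PiM {..T} (\<lambda>t. borel_of (X t))) \<subseteq> sets (borel_of (product_top T X))"
  proof (rule sets_PiM_in_sets)
    fix t A assume t: "t \<in> {..T}" and A: "A \<in> sets (borel_of (X t))"
    have "(\<lambda>s. s t) \<in> borel_of (product_top T X) \<rightarrow>\<^sub>M borel_of (X t)"
      unfolding borel_of_def[of "X t"]
    proof (rule measurable_measure_of)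
      fix U assume "U \<in> {U. openin (X t) U}"
      then have "openin (product_top T X) {s \<in> topspace (product_top T X). s t \<in> U}"
        using continuous_map_product_projection[OF t, of X] by (auto simp: continuous_map)
      then have "{s \<in> topspace (product_top T X). s t \<in> U} \<in> sets (borel_of (product_top T X))"
        by (rule openin_in_sets_borel_of)
      then show "(\<lambda>s. s t) -` U \<inter> space (borel_of (product_top T X))
                   \<in> sets (borel_of (product_top T X))"
        by (simp add: vimage_def Int_def conj_commute)
    qed (use t in \<open>auto dest: openin_subset\<close>)
    from measurable_sets[OF this A]
    show "{s \<in> space (borel_of (product_top T X)). s t \<in> A} \<in> sets (borel_of (product_top T X))"
      by (simp add: vimage_def Int_def conj_commute)
  qed simp
next
  have "\<exists>B. countable B \<and> (\<forall>V\<in>B. openin (X t) V) \<and>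
          (\<forall>U x. openin (X t) U \<and> x \<in> U \<longrightarrow> (\<exists>V\<in>B. x \<in> V \<and> V \<subseteq> U))" if "t \<in> {..T}" for t
    using polish_imp_second_countable[OF assms] that unfolding second_countable_def by auto
  then obtain B where B: "\<And>t. t \<in> {..T} \<Longrightarrow> countable (B t)"
      "\<And>t V. t \<in> {..T} \<Longrightarrow> V \<in> B t \<Longrightarrow> openin (X t) V"
      "\<And>t U x. t \<in> {..T} \<Longrightarrow> openin (X t) U \<Longrightarrow> x \<in> U \<Longrightarrow> \<exists>V\<in>B t. x \<in> V \<and> V \<subseteq> U"
    by metis
  define D where "D = PiE {..T} ` PiE {..T} B"
  have "countable D"
    unfolding D_def by (intro countable_image countable_PiE) (use B(1) in auto)
  have D_sets: "W \<in> sets (PiM {..T} (\<lambda>t. borel_of (X t)))" if "W \<in> D" for W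
  proof -
    from that obtain V where "V \<in> PiE {..T} B" "W = PiE {..T} V"
      by (auto simp: D_def)
    then show ?thesis
      using B(2) by (auto intro!: sets_PiM_I_finite openin_in_sets_borel_of simp: PiE_iff)
  qed
  have "U \<in> sets (PiM {..T} (\<lambda>t. borel_of (X t)))" if U: "openin (product_top T X) U" for U
  proof -
    have "\<exists>W\<in>D. s \<in> W \<and> W \<subseteq> U" if s: "s \<in> U" for s
    proof -
      from U s obtain A where A: "\<forall>t\<in>{..T}. openin (X t) (A t)" "s \<in> PiE {..T} A"
          "PiE {..T} A \<subseteq> U"
        unfolding openin_product_topology_alt by blast
      have "\<exists>V\<in>B t. s t \<in> V \<and> V \<subseteq> A t" if "t \<in> {..T}" for t
        using B(3)[OF that] A that by (auto simp: PiE_iff)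
      then obtain V where V: "\<And>t. t \<in> {..T} \<Longrightarrow> V t \<in> B t \<and> s t \<in> V t \<and> V t \<subseteq> A t"
        by metis
      have "PiE {..T} V = PiE {..T} (restrict V {..T})"
        by (rule PiE_cong) simp
      then have "PiE {..T} V \<in> D"
        unfolding D_def using V by (intro image_eqI[where x = "restrict V {..T}"]) auto
      moreover have "s \<in> PiE {..T} V"
        using V A(2) by (auto simp: PiE_iff)
      moreover have "PiE {..T} V \<subseteq> U"
        using V A(3) PiE_mono[of "{..T}" V A] by blast
      ultimately show ?thesis
        by blast
    qed
    then have "U = \<Union>{W \<in> D. W \<subseteq> U}"
      by blast
    moreover have "\<Union>{W \<in> D. W \<subseteq> U} \<in> sets (PiM {..T} (\<lambda>t. borel_of (X t)))"
      using \<open>countable D\<close> D_sets by (intro sets.countable_Union) (auto intro: countable_subset)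
    ultimately show ?thesis
      by simp
  qed
  then show "sets (borel_of (product_top T X)) \<subseteq> sets (PiM {..T} (\<lambda>t. borel_of (X t)))"
    unfolding sets_borel_of
    using sets.sigma_sets_subset[of "{U. openin (product_top T X) U}"
        "PiM {..T} (\<lambda>t. borel_of (X t))"]
    by (auto simp: space_PiM)
qed

end

theory Submission
  imports Defs
begin

text \<open>
  Write \<open>z = \<Sum>\<^sub>t x\<^sub>t\<close> and let \<open>h\<close> be the density of a measure satisfying the constraints of (A).
  Since \<open>h \<mu>\<close> and \<open>\<mu>\<close> have the same marginals, \<open>\<integral> h z d\<mu> = \<integral> z d\<mu>\<close>, so for dual feasible \<open>z\<close> and
  \<open>h\<close> of finite cost the sum of the two objectives is
  \<open>\<integral> [(\<phi> - h) (z + c)\<^sup>- + h (z + c)\<^sup>+] d\<mu> \<ge> 0\<close> (\<open>weak_duality\<close>). Once the infima are known to be attained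
  and opposite to each other, joint optimality means that this integral vanishes, which is
  complementary slackness. Two things remain: attainment, and the absence of a gap.

  Attainment in both problems rests on \<open>minimizing_sequence_AE_convergent\<close>: a convex functional
  with \<open>L\<^sup>1\<close>-bounded sublevel sets has a minimizing sequence that converges almost everywhere. The
  dual objective is coercive because \<open>\<phi> \<ge> v > 1\<close>, its integrand is bounded below by \<open>-c\<close>, and
  an almost everywhere limit of sums \<open>\<Sum>\<^sub>t x\<^sub>t\<close> is again such a sum (\<open>AE_limit_of_coord_sums\<close>); Fatou's
  lemma then yields a minimizer (\<open>dual_minimizer_exists\<close>). In the primal problem the
  densities are dominated by \<open>\<phi>\<close>, so the marginal constraints pass to the limit by dominated
  convergence (\<open>primal_minimizer_exists\<close>). Coercivity also makes every dual feasible \<open>z\<close> integrable, and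
  by Fubini's theorem the summands of an integrable sum are integrable (\<open>integrable_summand\<close>).

  To close the gap, replace the negative part by a smooth convex function \<open>q\<close> within \<open>\<epsilon> / 2\<close>
  above it. The smoothed dual problem has a minimizer \<open>z\<close>, whose first-order condition says that
  \<open>h = - \<phi> q'(z + c)\<close> satisfies the primal constraints (\<open>smooth_dual_stationary\<close>). For this pair the sum
  of the two objectives is at most \<open>\<epsilon> / 2 * \<integral> \<phi> d\<mu>\<close> (\<open>approximate_duality\<close>); let \<open>\<epsilon>\<close> tend to \<open>0\<close>.
\<close>

section \<open>A strictly convex function of linear growth\<close>

text \<open>The function \<open>a \<mapsto> \<surd>(1 + a\<^sup>2)\<close>: it is strictly convex, and it is integrable along every
  integrable function.\<close>

definition smooth_abs :: "real \<Rightarrow> real" where "smooth_abs a = sqrt (1 + a\<^sup>2)"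
text \<open>The derivative of \<^const>\<open>smooth_abs\<close>. It maps the line homeomorphically onto \<open>(-1, 1)\<close>.\<close>

definition smooth_sgn :: "real \<Rightarrow> real" where "smooth_sgn a = a / smooth_abs a"

lemma smooth_abs_ge_1: "1 \<le> smooth_abs a"
  by (simp add: smooth_abs_def)

lemma smooth_abs_ge_abs: "\<bar>a\<bar> \<le> smooth_abs a"
  by (simp add: smooth_abs_def real_le_rsqrt)

lemma smooth_abs_le: "smooth_abs a \<le> 1 + \<bar>a\<bar>"
  by (auto simp: smooth_abs_def power2_eq_square algebra_simps intro!: real_le_lsqrt)

lemma smooth_abs_square: "(smooth_abs a)\<^sup>2 = 1 + a\<^sup>2"
  by (simp add: smooth_abs_def add_nonneg_nonneg)

lemma abs_smooth_sgn_le_1: "\<bar>smooth_sgn a\<bar> \<le> 1"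
  using smooth_abs_ge_abs[of a] smooth_abs_ge_1[of a] by (simp add: smooth_sgn_def)

lemma measurable_smooth_abs [measurable]: "smooth_abs \<in> borel_measurable borel"
  unfolding smooth_abs_def[abs_def] by measurable

lemma measurable_smooth_sgn [measurable]: "smooth_sgn \<in> borel_measurable borel"
  unfolding smooth_sgn_def[abs_def] by measurable

lemma one_minus_smooth_sgn_square: "1 - (smooth_sgn a)\<^sup>2 = 1 / (smooth_abs a)\<^sup>2"
proof -
  have "(smooth_abs a)\<^sup>2 \<noteq> 0" using smooth_abs_ge_1[of a] by simp
  then show ?thesis
    by (simp add: smooth_sgn_def power_divide field_simps) (simp add: smooth_abs_square)
qed

lemma sqrt_le_tangent:
  assumes "0 < A" "0 \<le> A\<^sup>2 + D"
  shows "sqrt (A\<^sup>2 + D) \<le> A + D / (2 * A)"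
proof (rule real_le_lsqrt)
  have "A\<^sup>2 + D + (D / (2 * A))\<^sup>2 = (A + D / (2 * A))\<^sup>2"
    using assms by (simp add: power2_eq_square field_simps)
  then show "A\<^sup>2 + D \<le> (A + D / (2 * A))\<^sup>2"
    by (metis le_add_same_cancel1 zero_le_power2)
  have "- A\<^sup>2 \<le> D" using assms by simp
  then have "- A\<^sup>2 / (2 * A) \<le> D / (2 * A)"
    using assms by (intro divide_right_mono) auto
  then have "- (A/2) \<le> D / (2 * A)" using assms by (simp add: power2_eq_square)
  then show "0 \<le> A + D / (2 * A)" using assms by simp
qed

text \<open>
  Quantitative strict convexity. In the plane, \<open>smooth_abs a\<close> is the length of \<open>(1, a)\<close>, the bracket
  on the right is the defect in the triangle inequality for \<open>(1, a)\<close> and \<open>(1, b)\<close>, and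
  \<open>smooth_sgn a\<close> is one coordinate of the unit vector in the direction \<open>(1, a)\<close>. For vectors of
  length at least 1 the defect controls the squared distance of these unit vectors.
\<close>

lemma smooth_abs_midpoint_defect:
  "(smooth_sgn a - smooth_sgn b)\<^sup>2 \<le> 4 * (smooth_abs a + smooth_abs b - 2 * smooth_abs ((a + b) / 2))"
proof -
  define u v where "u = smooth_abs a" and "v = smooth_abs b"
  define D where "D = u * v - 1 - a * b"
  have u: "1 \<le> u" "u\<^sup>2 = 1 + a\<^sup>2" and v: "1 \<le> v" "v\<^sup>2 = 1 + b\<^sup>2"
    by (auto simp: u_def v_def smooth_abs_ge_1 smooth_abs_square)
  have a2: "a\<^sup>2 = u\<^sup>2 - 1" and b2: "b\<^sup>2 = v\<^sup>2 - 1" using u v by auto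
  have "2 * smooth_abs ((a + b) / 2) = sqrt (4 * (1 + ((a + b) / 2)\<^sup>2))"
    unfolding smooth_abs_def real_sqrt_mult by simp
  also have "4 * (1 + ((a + b) / 2)\<^sup>2) = (u + v)\<^sup>2 + (- 2 * D)"
    by (simp add: D_def power_divide power2_sum u v)
  also have "sqrt \<dots> \<le> (u + v) + (- 2 * D) / (2 * (u + v))"
  proof (rule sqrt_le_tangent)
    show "0 \<le> (u + v)\<^sup>2 + (- 2 * D)"
      unfolding D_def power2_sum u v using zero_le_power2[of "a + b"]
      by (simp add: power2_sum algebra_simps)
  qed (use u v in auto)
  also have "(- 2 * D) / (2 * (u + v)) = - (D / (u + v))"
    by (metis minus_divide_left mult_divide_mult_cancel_left mult_minus_left mult_minus_right zero_neq_numeral)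
  finally have 1: "D / (u + v) \<le> smooth_abs a + smooth_abs b - 2 * smooth_abs ((a + b) / 2)"
    by (simp add: u_def v_def)
  have "(smooth_sgn a - smooth_sgn b)\<^sup>2 + (1 / u - 1 / v)\<^sup>2 = (a\<^sup>2 + 1) / u\<^sup>2 + (b\<^sup>2 + 1) / v\<^sup>2 - 2 * (1 + a * b) / (u * v)"
    unfolding smooth_sgn_def u_def[symmetric] v_def[symmetric] using u(1) v(1)
    by (simp add: field_simps power2_eq_square)
  also have "\<dots> = 2 * D / (u * v)"
    unfolding a2 b2 D_def using u(1) v(1) by (simp add: field_simps power2_eq_square)
  finally have 2: "(smooth_sgn a - smooth_sgn b)\<^sup>2 \<le> 2 * D / (u * v)"
    by (smt (verit) zero_le_power2)
  then have "0 \<le> 2 * D / (u * v)"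
    by (smt (verit) zero_le_power2)
  moreover have "0 < u * v" using u(1) v(1) by simp
  ultimately have "0 \<le> D" by (simp add: zero_le_divide_iff)
  have "u + v \<le> 2 * (u * v)"
    using mult_left_mono[of 1 v u] mult_right_mono[of 1 u v] u(1) v(1) by linarith
  then have "4 * (D / (2 * (u * v))) \<le> 4 * (D / (u + v))"
    using \<open>0 \<le> D\<close> u v by (intro mult_left_mono divide_left_mono mult_pos_pos) auto
  with 1 2 show ?thesis by simp
qed

lemma (in finite_measure) integrable_smooth_abs:
  assumes "integrable M z"
  shows "integrable M (\<lambda>s. smooth_abs (z s))"
proof (rule Bochner_Integration.integrable_bound)
  show "integrable M (\<lambda>s. 1 + \<bar>z s\<bar>)" using assms by auto
  show "AE s in M. norm (smooth_abs (z s)) \<le> norm (1 + \<bar>z s\<bar>)"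
    using smooth_abs_le smooth_abs_ge_1 by (auto intro!: AE_I2 simp: abs_of_nonneg order_trans[OF zero_le_one smooth_abs_ge_1])
qed (use assms in measurable)

section \<open>Minimizing sequences that converge almost everywhere\<close>

lemma fatou_lower_bound:
  fixes f :: "'s \<Rightarrow> real"
  assumes [measurable]: "f \<in> borel_measurable M"
    and g: "integrable M g"
    and int: "\<And>n. integrable M (F n)"
    and ge: "\<And>n. AE s in M. g s \<le> F n s"
    and lim: "AE s in M. (\<lambda>n. F n s) \<longlonglongrightarrow> f s"
    and L: "(\<lambda>n. \<integral>s. F n s \<partial>M) \<longlonglongrightarrow> L"
  shows "integrable M f" "(\<integral>s. f s \<partial>M) \<le> L"
proof -
  have [measurable]: "g \<in> borel_measurable M" "\<And>n. F n \<in> borel_measurable M"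
    using g int by auto
  have ge_all: "AE s in M. \<forall>n. g s \<le> F n s" using ge by (simp add: AE_all_countable)
  have pos: "AE s in M. 0 \<le> f s - g s"
    using ge_all lim
  proof eventually_elim
    case (elim s)
    have "g s \<le> f s" by (rule LIMSEQ_le_const[OF elim(2)]) (use elim(1) in auto)
    then show ?case by simp
  qed
  have le: "(\<integral>s. g s \<partial>M) \<le> L"
    by (rule LIMSEQ_le_const[OF L]) (use g int ge in \<open>auto intro!: integral_mono_AE\<close>)
  have "(\<integral>\<^sup>+s. ennreal (f s - g s) \<partial>M) = (\<integral>\<^sup>+s. liminf (\<lambda>n. ennreal (F n s - g s)) \<partial>M)"
  proof (rule nn_integral_cong_AE, use lim in eventually_elim)
    case (elim s)
    have "(\<lambda>n. ennreal (F n s - g s)) \<longlonglongrightarrow> ennreal (f s - g s)"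
      using elim by (intro tendsto_ennrealI tendsto_intros)
    then show ?case by (metis lim_imp_Liminf trivial_limit_sequentially)
  qed
  also have "\<dots> \<le> liminf (\<lambda>n. \<integral>\<^sup>+s. ennreal (F n s - g s) \<partial>M)"
    by (intro nn_integral_liminf) measurable
  also have "(\<lambda>n. \<integral>\<^sup>+s. ennreal (F n s - g s) \<partial>M) = (\<lambda>n. ennreal ((\<integral>s. F n s \<partial>M) - (\<integral>s. g s \<partial>M)))"
  proof
    fix n
    have "(\<integral>\<^sup>+s. ennreal (F n s - g s) \<partial>M) = ennreal (\<integral>s. F n s - g s \<partial>M)"
      using g int ge[of n] by (intro nn_integral_eq_integral) auto
    then show "(\<integral>\<^sup>+s. ennreal (F n s - g s) \<partial>M) = ennreal ((\<integral>s. F n s \<partial>M) - (\<integral>s. g s \<partial>M))"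
      using g int by simp
  qed
  also have "liminf \<dots> = ennreal (L - (\<integral>s. g s \<partial>M))"
    by (intro lim_imp_Liminf tendsto_ennrealI tendsto_intros L) auto
  finally have fin: "(\<integral>\<^sup>+s. ennreal (f s - g s) \<partial>M) \<le> ennreal (L - (\<integral>s. g s \<partial>M))" .
  then have "(\<integral>\<^sup>+s. ennreal (f s - g s) \<partial>M) < \<infinity>"
    by (simp add: le_less_trans)
  with pos have int_d: "integrable M (\<lambda>s. f s - g s)"
    by (intro integrableI_nonneg) auto
  have "integrable M (\<lambda>s. (f s - g s) + g s)"
    using int_d g by (rule Bochner_Integration.integrable_add)
  then show f: "integrable M f" by simp
  have "ennreal (\<integral>s. f s - g s \<partial>M) \<le> ennreal (L - (\<integral>s. g s \<partial>M))"
    using fin nn_integral_eq_integral[OF int_d pos] by simp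
  then have "(\<integral>s. f s - g s \<partial>M) \<le> L - (\<integral>s. g s \<partial>M)"
    using le by (simp add: ennreal_le_iff)
  then show "(\<integral>s. f s \<partial>M) \<le> L" using f g by simp
qed

text \<open>
  A substitute for weak compactness. A midpoint convex functional whose sublevel sets are bounded in
  \<open>L\<^sup>1\<close> has a minimizing sequence converging almost everywhere to a finite limit. The sequence
  is found by minimizing \<open>\<integral> smooth_abs z\<close> approximately over the shrinking convex sets of
  near-minimizers: as in the parallelogram argument for closest points in a Hilbert space, the
  midpoint defect forces \<open>smooth_sgn z\<close> to be Cauchy in \<open>L\<^sup>2\<close>.
\<close>

lemma (in prob_space) minimizing_sequence_AE_convergent:
  fixes C :: "('a \<Rightarrow> real) set" and J :: "('a \<Rightarrow> real) \<Rightarrow> real"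
  assumes ne: "C \<noteq> {}"
    and int: "\<And>z. z \<in> C \<Longrightarrow> integrable M z"
    and mid: "\<And>z w. z \<in> C \<Longrightarrow> w \<in> C \<Longrightarrow> (\<lambda>s. (z s + w s) / 2) \<in> C"
    and conv: "\<And>z w. z \<in> C \<Longrightarrow> w \<in> C \<Longrightarrow> J (\<lambda>s. (z s + w s) / 2) \<le> (J z + J w) / 2"
    and bdd: "\<And>z. z \<in> C \<Longrightarrow> b \<le> J z"
    and coercive: "\<And>z. z \<in> C \<Longrightarrow> (\<integral>s. \<bar>z s\<bar> \<partial>M) \<le> \<alpha> + \<beta> * J z"
    and "0 \<le> \<beta>"
  obtains Z z where "\<And>n. Z n \<in> C" "(\<lambda>n. J (Z n)) \<longlonglongrightarrow> (INF w\<in>C. J w)"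
    "z \<in> borel_measurable M" "AE s in M. (\<lambda>n. Z n s) \<longlonglongrightarrow> z s"
proof -
  define I where "I = (INF w\<in>C. J w)"
  define e where "e n = 1 / real (Suc n)" for n
  have e_pos: "0 < e n" for n by (simp add: e_def)
  have e_anti: "e n \<le> e k" if "k \<le> n" for n k using that by (simp add: e_def frac_le)
  have e_le: "e n \<le> 1" for n by (simp add: e_def)
  have e_lim: "e \<longlonglongrightarrow> 0" unfolding e_def[abs_def] using LIMSEQ_inverse_real_of_nat by (simp add: field_simps)
  define D where "D n = {z \<in> C. J z \<le> I + e n}" for n
  define F where "F z = (\<integral>s. smooth_abs (z s) \<partial>M)" for z
  define G where "G n = (INF z\<in>D n. F z)" for n
  have bdd': "bdd_below (J ` C)" using bdd by (intro bdd_belowI[of _ b]) auto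
  have I_le: "I \<le> J z" if "z \<in> C" for z unfolding I_def using bdd' that by (rule cINF_lower)
  have F_ge: "1 \<le> F z" if "z \<in> C" for z
    unfolding F_def using integral_mono[of M "\<lambda>_. 1" "\<lambda>s. smooth_abs (z s)"] int[OF that]
    by (auto simp: smooth_abs_ge_1 integrable_smooth_abs prob_space)
  define B where "B = 1 + \<alpha> + \<beta> * (I + 1)"
  have F_le: "F z \<le> B" if "z \<in> D n" for z n
  proof -
    have z: "z \<in> C" and Jz: "J z \<le> I + 1" using that e_le[of n] by (auto simp: D_def)
    have "F z \<le> (\<integral>s. 1 + \<bar>z s\<bar> \<partial>M)"
      unfolding F_def using int[OF z] by (intro integral_mono integrable_smooth_abs) (auto simp: smooth_abs_le)
    also have "\<dots> = 1 + (\<integral>s. \<bar>z s\<bar> \<partial>M)" using int[OF z] by (simp add: prob_space)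
    also have "\<dots> \<le> 1 + (\<alpha> + \<beta> * (I + 1))"
      using coercive[OF z] mult_left_mono[OF Jz \<open>0 \<le> \<beta>\<close>] by simp
    finally show ?thesis by (simp add: B_def)
  qed
  have D_ne: "D n \<noteq> {}" for n
  proof -
    have "\<exists>w\<in>C. J w < I + e n"
      using cINF_less_iff[OF ne bdd', of "I + e n"] e_pos[of n] unfolding I_def by auto
    then show ?thesis by (auto simp: D_def intro: less_imp_le)
  qed
  have D_anti: "D n \<subseteq> D k" if "k \<le> n" for n k using e_anti[OF that] by (auto simp: D_def)
  have bdd_F: "bdd_below (F ` D n)" for n
    using F_ge by (intro bdd_belowI[of _ 1]) (auto simp: D_def)
  have G_mono: "G k \<le> G n" if "k \<le> n" for n k
    unfolding G_def by (rule cINF_superset_mono[OF D_ne bdd_F D_anti[OF that]]) simp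
  have G_le: "G n \<le> F z" if "z \<in> D n" for n z unfolding G_def using bdd_F that by (rule cINF_lower)
  have "\<exists>z\<in>D n. F z < G n + e n" for n
    using cINF_less_iff[OF D_ne bdd_F, of n "G n + e n"] e_pos[of n] unfolding G_def by auto
  then obtain Z where Z: "\<And>n. Z n \<in> D n" "\<And>n. F (Z n) < G n + e n" by metis
  have ZC: "Z n \<in> C" for n using Z(1) by (auto simp: D_def)
  note Zint = int[OF ZC]
  have [measurable]: "Z n \<in> borel_measurable M" for n using Zint by auto
  have G_conv: "convergent G"
  proof (rule Bseq_monoseq_convergent)
    have "1 \<le> G n" "G n \<le> B" for n
    proof -
      show "1 \<le> G n" unfolding G_def using F_ge by (intro cINF_greatest[OF D_ne]) (auto simp: D_def)
      show "G n \<le> B" using G_le[OF Z(1)] F_le[OF Z(1)] order_trans by blast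
    qed
    then show "Bseq G" by (intro BseqI'[of _ B]) (auto simp: abs_if, smt (verit))
    show "monoseq G" using G_mono by (auto simp: monoseq_def)
  qed
  then have G_Cauchy: "Cauchy G" by (rule convergent_Cauchy)
  have int_sq: "integrable M (\<lambda>s. smooth_sgn (Z n s))" for n
    by (rule integrable_const_bound[of _ 1]) (auto simp: abs_smooth_sgn_le_1)
  have int_sq2: "integrable M (\<lambda>s. (smooth_sgn (Z n s) - smooth_sgn (Z k s))\<^sup>2)" for n k
  proof (rule integrable_const_bound[of _ 4])
    have "(smooth_sgn a - smooth_sgn b)\<^sup>2 \<le> 2\<^sup>2" for a b
      using abs_smooth_sgn_le_1[of a] abs_smooth_sgn_le_1[of b] by (intro power2_le_iff_abs_le[THEN iffD2]) auto
    then show "AE s in M. norm ((smooth_sgn (Z n s) - smooth_sgn (Z k s))\<^sup>2) \<le> 4" by simp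
  qed measurable
  \<comment> \<open>the midpoint of two near-minimizers is one too, so it cannot decrease the second functional by much\<close>
  have sq_est: "(\<integral>s. (smooth_sgn (Z n s) - smooth_sgn (Z k s))\<^sup>2 \<partial>M) \<le> 4 * ((G n - G k) + 2 * e k)" if "k \<le> n" for n k
  proof -
    have Zn: "Z n \<in> D k" using Z(1)[of n] D_anti[OF that] by auto
    let ?w = "\<lambda>s. (Z n s + Z k s) / 2"
    have w: "?w \<in> D k"
      using mid[OF ZC ZC] conv[OF ZC ZC, of n k] Z(1)[of k] Zn by (auto simp: D_def)
    have wint: "integrable M ?w" using int[OF mid[OF ZC ZC]] .
    have "(\<integral>s. (smooth_sgn (Z n s) - smooth_sgn (Z k s))\<^sup>2 \<partial>M) \<le> (\<integral>s. 4 * (smooth_abs (Z n s) + smooth_abs (Z k s) - 2 * smooth_abs (?w s)) \<partial>M)"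
      by (intro integral_mono int_sq2 smooth_abs_midpoint_defect integrable_mult_right Bochner_Integration.integrable_add
          Bochner_Integration.integrable_diff integrable_smooth_abs Zint wint)
    also have "\<dots> = 4 * (F (Z n) + F (Z k) - 2 * F ?w)"
      using integrable_smooth_abs[OF Zint[of n]] integrable_smooth_abs[OF Zint[of k]] integrable_smooth_abs[OF wint] by (simp add: F_def)
    also have "\<dots> \<le> 4 * ((G n - G k) + 2 * e k)"
      using G_le[OF w] Z(2)[of n] Z(2)[of k] e_anti[OF that] by simp
    finally show ?thesis .
  qed
  have L1_est: "\<exists>N. \<forall>i\<ge>N. \<forall>j\<ge>N. (\<integral>s. norm (smooth_sgn (Z i s) - smooth_sgn (Z j s)) \<partial>M) < \<epsilon>" if "\<epsilon> > 0" for \<epsilon>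
  proof -
    define \<delta> where "\<delta> = \<epsilon>\<^sup>2 / 16"
    have d: "0 < \<delta>" using that by (simp add: \<delta>_def)
    obtain N1 where N1: "\<And>i j. i \<ge> N1 \<Longrightarrow> j \<ge> N1 \<Longrightarrow> dist (G i) (G j) < \<delta>"
      using G_Cauchy d unfolding Cauchy_def by blast
    obtain N2 where N2: "\<And>i. i \<ge> N2 \<Longrightarrow> e i < \<delta>"
      using order_tendstoD(2)[OF e_lim d] by (auto simp: eventually_sequentially)
    have key: "(\<integral>s. norm (smooth_sgn (Z n s) - smooth_sgn (Z k s)) \<partial>M) < \<epsilon>" if "k \<ge> max N1 N2" "k \<le> n" for n k
    proof -
      have "(\<integral>s. norm (smooth_sgn (Z n s) - smooth_sgn (Z k s)) \<partial>M)\<^sup>2 \<le> (\<integral>s. (norm (smooth_sgn (Z n s) - smooth_sgn (Z k s)))\<^sup>2 \<partial>M)"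
      proof -
        have "0 \<le> variance (\<lambda>s. norm (smooth_sgn (Z n s) - smooth_sgn (Z k s)))" by (rule variance_positive)
        also have "\<dots> = (\<integral>s. (norm (smooth_sgn (Z n s) - smooth_sgn (Z k s)))\<^sup>2 \<partial>M) - (\<integral>s. norm (smooth_sgn (Z n s) - smooth_sgn (Z k s)) \<partial>M)\<^sup>2"
          using int_sq int_sq2 by (intro variance_eq) auto
        finally show ?thesis by simp
      qed
      also have "\<dots> \<le> 4 * ((G n - G k) + 2 * e k)" using sq_est[OF that(2)] by simp
      also have "\<dots> < 4 * (\<delta> + 2 * \<delta>)"
        using N1[of n k] N2[of k] that by (simp add: dist_real_def)
      also have "\<dots> \<le> \<epsilon>\<^sup>2" using that by (simp add: \<delta>_def)
      finally show ?thesis using \<open>\<epsilon> > 0\<close> by (simp add: power2_less_imp_less)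
    qed
    show ?thesis
    proof (intro exI[of _ "max N1 N2"] allI impI)
      fix i j assume ij: "max N1 N2 \<le> i" "max N1 N2 \<le> j"
      show "(\<integral>s. norm (smooth_sgn (Z i s) - smooth_sgn (Z j s)) \<partial>M) < \<epsilon>"
      proof (cases "j \<le> i")
        case True then show ?thesis using key ij by auto
      next
        case False
        then show ?thesis using key[of i j] ij by (subst norm_minus_commute) auto
      qed
    qed
  qed
  obtain r where r: "strict_mono r" and Cau: "AE s in M. Cauchy (\<lambda>i. smooth_sgn (Z (r i) s))"
    using cauchy_L1_AE_cauchy_subseq[OF int_sq L1_est] by blast
  define w where "w s = lim (\<lambda>i. smooth_sgn (Z (r i) s))" for s
  have [measurable]: "w \<in> borel_measurable M"
    unfolding w_def by (rule borel_measurable_lim_metric) measurable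
  have w_lim: "AE s in M. (\<lambda>i. smooth_sgn (Z (r i) s)) \<longlonglongrightarrow> w s"
    using Cau by eventually_elim (metis w_def real_Cauchy_convergent convergent_LIMSEQ_iff)
  \<comment> \<open>by Fatou the limit of \<open>smooth_sgn (Z (r i))\<close> almost never is \<open>\<plusminus>1\<close>, so that \<open>smooth_sgn\<close> can be
      inverted at it\<close>
  have "(\<integral>\<^sup>+s. liminf (\<lambda>i. ennreal (smooth_abs (Z (r i) s))) \<partial>M) \<le> liminf (\<lambda>i. \<integral>\<^sup>+s. ennreal (smooth_abs (Z (r i) s)) \<partial>M)"
    by (intro nn_integral_liminf) measurable
  also have "\<dots> \<le> ennreal B"
  proof (rule Liminf_le)
    show "\<forall>\<^sub>F i in sequentially. (\<integral>\<^sup>+s. ennreal (smooth_abs (Z (r i) s)) \<partial>M) \<le> ennreal B"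
    proof (intro always_eventually allI)
      fix i
      have "(\<integral>\<^sup>+s. ennreal (smooth_abs (Z (r i) s)) \<partial>M) = ennreal (F (Z (r i)))"
        unfolding F_def using smooth_abs_ge_1 order_trans[OF zero_le_one]
        by (intro nn_integral_eq_integral integrable_smooth_abs Zint AE_I2) blast
      then show "(\<integral>\<^sup>+s. ennreal (smooth_abs (Z (r i) s)) \<partial>M) \<le> ennreal B"
        using F_le[OF Z(1)] by (simp add: ennreal_leI)
    qed
  qed simp
  finally have "(\<integral>\<^sup>+s. liminf (\<lambda>i. ennreal (smooth_abs (Z (r i) s))) \<partial>M) \<noteq> \<infinity>"
    by (auto simp: top_unique)
  then have fin: "AE s in M. liminf (\<lambda>i. ennreal (smooth_abs (Z (r i) s))) \<noteq> \<infinity>"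
    by (intro nn_integral_PInf_AE) measurable
  have lim: "AE s in M. (\<lambda>i. Z (r i) s) \<longlonglongrightarrow> w s / sqrt (1 - (w s)\<^sup>2)"
    using fin w_lim
  proof eventually_elim
    case (elim s)
    let ?h = "\<lambda>i. smooth_abs (Z (r i) s)"
    have hpos: "0 < ?h i" for i using smooth_abs_ge_1[of "Z (r i) s"] by simp
    have inv: "sqrt (1 - (smooth_sgn (Z (r i) s))\<^sup>2) = inverse (?h i)" for i
      using hpos[of i] by (simp add: one_minus_smooth_sgn_square real_sqrt_divide inverse_eq_divide)
    have l: "(\<lambda>i. inverse (?h i)) \<longlonglongrightarrow> sqrt (1 - (w s)\<^sup>2)"
      unfolding inv[symmetric] by (intro tendsto_intros elim)
    have "sqrt (1 - (w s)\<^sup>2) \<noteq> 0"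
    proof
      assume "sqrt (1 - (w s)\<^sup>2) = 0"
      with l have "(\<lambda>i. inverse (?h i)) \<longlonglongrightarrow> 0" by simp
      then have "filterlim ?h at_top sequentially"
        using hpos filterlim_inverse_at_top[of "\<lambda>i. inverse (?h i)" sequentially] by simp
      then have "((\<lambda>i. ennreal (?h i)) \<longlongrightarrow> \<infinity>) sequentially"
        unfolding infinity_ennreal_def ennreal_tendsto_top_eq_at_top .
      from lim_imp_Liminf[OF trivial_limit_sequentially this] elim(1) show False by simp
    qed
    moreover have "Z (r i) s = smooth_sgn (Z (r i) s) / inverse (?h i)" for i
      using hpos[of i] by (simp add: smooth_sgn_def)
    ultimately show ?case
      by (subst \<open>\<And>i. Z (r i) s = _\<close>) (intro tendsto_divide elim l)
  qed
  show ?thesis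
  proof (rule that)
    show "Z (r n) \<in> C" for n by (rule ZC)
    have "(\<lambda>n. J (Z n)) \<longlonglongrightarrow> I"
    proof (rule tendsto_sandwich[OF _ _ tendsto_const[of I]])
      show "(\<lambda>n. I + e n) \<longlonglongrightarrow> I" using tendsto_add[OF tendsto_const e_lim, of I] by simp
    qed (use Z(1) I_le in \<open>auto simp: D_def\<close>)
    from LIMSEQ_subseq_LIMSEQ[OF this r]
    show "(\<lambda>n. J (Z (r n))) \<longlonglongrightarrow> (INF w\<in>C. J w)" by (simp add: o_def I_def)
    show "(\<lambda>s. w s / sqrt (1 - (w s)\<^sup>2)) \<in> borel_measurable M" by measurable
  qed (rule lim)
qed

section \<open>A smooth approximation of the negative part\<close>

text \<open>The second derivative of \<^const>\<open>smooth_abs\<close> is at most 1, so the function lies below its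
  tangent plus half the square of the increment.\<close>

lemma smooth_abs_tangent:
  "smooth_abs (a + b) \<le> smooth_abs a + smooth_sgn a * b + b\<^sup>2 / 2"
proof -
  have pos: "0 < smooth_abs a" using smooth_abs_ge_1[of a] by simp
  have eq: "1 + (a + b)\<^sup>2 = (smooth_abs a)\<^sup>2 + (2 * a * b + b\<^sup>2)"
    by (simp add: smooth_abs_square power2_sum)
  have "smooth_abs (a + b) = sqrt ((smooth_abs a)\<^sup>2 + (2 * a * b + b\<^sup>2))"
    by (simp add: smooth_abs_def[of "a + b"] eq)
  also have "\<dots> \<le> smooth_abs a + (2 * a * b + b\<^sup>2) / (2 * smooth_abs a)"
    by (rule sqrt_le_tangent[OF pos]) (simp add: eq[symmetric] add_nonneg_nonneg)
  also have "\<dots> = smooth_abs a + smooth_sgn a * b + b\<^sup>2 / (2 * smooth_abs a)"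
    using pos by (simp add: smooth_sgn_def field_simps)
  also have "\<dots> \<le> smooth_abs a + smooth_sgn a * b + b\<^sup>2 / 2"
    using smooth_abs_ge_1[of a] by (intro add_left_mono divide_left_mono) auto
  finally show ?thesis .
qed

text \<open>Replacing \<open>\<bar>w\<bar>\<close> by \<open>\<surd>(\<epsilon>\<^sup>2 + w\<^sup>2)\<close> in \<open>(\<bar>w\<bar> - w) / 2\<close> gives a smooth convex approximation of the
  negative part, with error at most \<open>\<epsilon> / 2\<close>.\<close>

definition smooth_neg :: "real \<Rightarrow> real \<Rightarrow> real" where
  "smooth_neg \<epsilon> w = (\<epsilon> * smooth_abs (w / \<epsilon>) - w) / 2"

text \<open>The derivative of \<open>smooth_neg \<epsilon>\<close>, with the sign changed so that it lies in \<open>[0, 1]\<close>.\<close>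

definition smooth_neg_slope :: "real \<Rightarrow> real \<Rightarrow> real" where
  "smooth_neg_slope \<epsilon> w = (1 - smooth_sgn (w / \<epsilon>)) / 2"

lemma smooth_neg_slope_bounds: "0 \<le> smooth_neg_slope \<epsilon> w" "smooth_neg_slope \<epsilon> w \<le> 1"
  using abs_smooth_sgn_le_1[of "w / \<epsilon>"] by (auto simp: smooth_neg_slope_def abs_le_iff)

lemma measurable_smooth_neg_slope [measurable]: "smooth_neg_slope \<epsilon> \<in> borel_measurable borel"
  unfolding smooth_neg_slope_def[abs_def] by measurable

lemma smooth_neg_continuous: "continuous_on UNIV (smooth_neg \<epsilon>)"
proof (cases "\<epsilon> = 0")
  case True then show ?thesis by (auto simp: smooth_neg_def[abs_def] intro!: continuous_intros)
next
  case False
  then show ?thesis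
    unfolding smooth_neg_def[abs_def] smooth_abs_def by (intro continuous_intros) auto
qed

lemma neg_part_alt: "neg_part w = (\<bar>w\<bar> - w) / 2"
  by (auto simp: neg_part_def)

context
  fixes \<epsilon> :: real
  assumes eps: "0 < \<epsilon>"
begin

lemma smooth_neg_bounds: "neg_part w \<le> smooth_neg \<epsilon> w" "smooth_neg \<epsilon> w \<le> neg_part w + \<epsilon> / 2"
proof -
  have "\<bar>w\<bar> = \<epsilon> * \<bar>w / \<epsilon>\<bar>" using eps by (simp add: abs_divide)
  then have "\<bar>w\<bar> \<le> \<epsilon> * smooth_abs (w / \<epsilon>)" "\<epsilon> * smooth_abs (w / \<epsilon>) \<le> \<epsilon> + \<bar>w\<bar>"
    using mult_left_mono[OF smooth_abs_ge_abs[of "w / \<epsilon>"], of \<epsilon>]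
      mult_left_mono[OF smooth_abs_le[of "w / \<epsilon>"], of \<epsilon>] eps by (auto simp: distrib_left)
  then show "neg_part w \<le> smooth_neg \<epsilon> w" "smooth_neg \<epsilon> w \<le> neg_part w + \<epsilon> / 2"
    by (auto simp: neg_part_alt smooth_neg_def field_simps)
qed

lemma smooth_neg_midpoint_convex:
  "smooth_neg \<epsilon> ((a + b) / 2) \<le> (smooth_neg \<epsilon> a + smooth_neg \<epsilon> b) / 2"
proof -
  have "2 * smooth_abs ((a / \<epsilon> + b / \<epsilon>) / 2) \<le> smooth_abs (a / \<epsilon>) + smooth_abs (b / \<epsilon>)"
    using order_trans[OF zero_le_power2 smooth_abs_midpoint_defect[of "a / \<epsilon>" "b / \<epsilon>"]]
    by (simp add: zero_le_mult_iff)
  moreover have "(a / \<epsilon> + b / \<epsilon>) / 2 = (a + b) / 2 / \<epsilon>"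
    using eps by (simp add: field_simps)
  ultimately have "\<epsilon> * (2 * smooth_abs ((a + b) / 2 / \<epsilon>)) \<le> \<epsilon> * (smooth_abs (a / \<epsilon>) + smooth_abs (b / \<epsilon>))"
    using eps by simp
  then show ?thesis unfolding smooth_neg_def by (simp add: algebra_simps add_divide_distrib diff_divide_distrib)
qed

lemma smooth_neg_tangent:
  "smooth_neg \<epsilon> (w + d) \<le> smooth_neg \<epsilon> w - smooth_neg_slope \<epsilon> w * d + d\<^sup>2 / (4 * \<epsilon>)"
proof -
  have "\<epsilon> * smooth_abs ((w + d) / \<epsilon>) \<le> \<epsilon> * (smooth_abs (w / \<epsilon>) + smooth_sgn (w / \<epsilon>) * (d / \<epsilon>) + (d / \<epsilon>)\<^sup>2 / 2)"
    using smooth_abs_tangent[of "w / \<epsilon>" "d / \<epsilon>"] eps by (simp add: add_divide_distrib)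
  also have "\<dots> = \<epsilon> * smooth_abs (w / \<epsilon>) + smooth_sgn (w / \<epsilon>) * d + d\<^sup>2 / (2 * \<epsilon>)"
    using eps by (simp add: field_simps power2_eq_square)
  finally show ?thesis unfolding smooth_neg_def smooth_neg_slope_def by (simp add: field_simps)
qed

text \<open>The Fenchel gap of the approximation at a point and its own slope; the exact negative part
  would give \<open>0\<close>.\<close>

lemma smooth_neg_gap:
  "0 \<le> smooth_neg \<epsilon> w + smooth_neg_slope \<epsilon> w * w"
  "smooth_neg \<epsilon> w + smooth_neg_slope \<epsilon> w * w \<le> \<epsilon> / 2"
proof -
  define a where "a = w / \<epsilon>"
  have w: "w = \<epsilon> * a" using eps by (simp add: a_def)
  have pos: "1 \<le> smooth_abs a" by (rule smooth_abs_ge_1)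
  have "smooth_abs a - smooth_sgn a * a = ((smooth_abs a)\<^sup>2 - a\<^sup>2) / smooth_abs a"
    using pos by (simp add: smooth_sgn_def field_simps power2_eq_square)
  also have "\<dots> = 1 / smooth_abs a" by (simp add: smooth_abs_square)
  finally have "smooth_abs a = smooth_sgn a * a + 1 / smooth_abs a" by simp
  then have "\<epsilon> * smooth_abs a = \<epsilon> * (smooth_sgn a * a + 1 / smooth_abs a)" by (rule arg_cong)
  then have "smooth_neg \<epsilon> w + smooth_neg_slope \<epsilon> w * w = \<epsilon> / 2 * (1 / smooth_abs a)"
    unfolding smooth_neg_def smooth_neg_slope_def a_def[symmetric] by (simp add: w algebra_simps diff_divide_distrib add_divide_distrib)
  then show "0 \<le> smooth_neg \<epsilon> w + smooth_neg_slope \<epsilon> w * w"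
    "smooth_neg \<epsilon> w + smooth_neg_slope \<epsilon> w * w \<le> \<epsilon> / 2"
    using pos eps mult_left_mono[of "1 / smooth_abs a" 1 "\<epsilon> / 2"] by auto
qed

end

section \<open>Sums of functions of one coordinate on a product space\<close>

locale product_of_prob_spaces =
  fixes T :: nat and m :: "nat \<Rightarrow> 'a measure"
  assumes prob: "\<And>t. t \<le> T \<Longrightarrow> prob_space (m t)"
begin

abbreviation P :: "(nat \<Rightarrow> 'a) measure" where "P \<equiv> PiM {..T} m"

sublocale P: prob_space P
  by (rule prob_space_PiM) (simp add: prob)

lemma measurable_coordinate [measurable]: "t \<le> T \<Longrightarrow> (\<lambda>s. s t) \<in> P \<rightarrow>\<^sub>M m t"
  by (rule measurable_component_singleton) simp

lemma measurable_coord_sum: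
  assumes "\<And>t. t \<le> T \<Longrightarrow> x t \<in> borel_measurable (m t)"
  shows "coord_sum T x \<in> borel_measurable P"
  unfolding coord_sum_def
  by (intro borel_measurable_sum measurable_compose[OF measurable_coordinate assms]) auto

lemma measurable_substitute: "t \<le> T \<Longrightarrow> (\<lambda>(u, s). s(t := u)) \<in> (m t \<Otimes>\<^sub>M P) \<rightarrow>\<^sub>M P"
  unfolding split_beta' by (rule measurable_fun_upd[where J = "{..T}"]) auto

text \<open>Resampling one coordinate independently preserves the product measure. For almost every
  base point \<open>s\<close>, a property that holds almost everywhere thus holds at \<open>s(t := u)\<close> for almost every \<open>u\<close>;
  there a sum of functions of one coordinate varies with its \<open>t\<close>-th summand only.\<close>

lemma distr_substitute: "t \<le> T \<Longrightarrow> distr (m t \<Otimes>\<^sub>M P) P (\<lambda>(u, s). s(t := u)) = P"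
  using distr_pair_PiM_eq_PiM[of "{..T}" m t] prob by (simp add: insert_absorb)

lemma coord_sum_update:
  assumes "t \<le> T"
  shows "coord_sum T x (s(t := u)) = coord_sum T x s - x t (s t) + x t u"
proof -
  have "coord_sum T x r = x t (r t) + (\<Sum>i\<in>{..T} - {t}. x i (r i))" for r
    unfolding coord_sum_def using assms by (intro sum.remove) auto
  moreover have "(\<Sum>i\<in>{..T} - {t}. x i ((s(t := u)) i)) = (\<Sum>i\<in>{..T} - {t}. x i (s i))"
    by (rule sum.cong) auto
  ultimately show ?thesis by simp
qed

lemma AE_substitute:
  assumes t: "t \<le> T" and ae: "AE s in P. Q s" and Q [measurable]: "Measurable.pred P Q"
  shows "AE s in P. AE u in m t. Q (s(t := u))"
proof -
  interpret mt: prob_space "m t" using prob t by simp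
  interpret pair_sigma_finite "m t" P ..
  note [measurable] = measurable_substitute[OF t]
  have "AE p in m t \<Otimes>\<^sub>M P. Q ((\<lambda>(u, s). s(t := u)) p)"
    using ae by (subst (asm) distr_substitute[OF t, symmetric]) (simp add: AE_distr_iff)
  from AE_pair[OF this] have "AE u in m t. AE s in P. Q (s(t := u))" by simp
  then show ?thesis
    by (subst (asm) AE_commute) 
       (use measurable_sets[OF measurable_substitute[OF t] predE[OF Q]] in 
         \<open>auto simp: split_beta\<close>)
qed

lemma integrable_summand:
  assumes x: "\<And>t. t \<le> T \<Longrightarrow> x t \<in> borel_measurable (m t)"
    and int: "integrable P (coord_sum T x)" and t: "t \<le> T"
  shows "integrable (m t) (x t)"
proof -
  interpret mt: prob_space "m t" using prob t by simp
  interpret pair_sigma_finite "m t" P ..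
  note [measurable] = measurable_substitute[OF t] measurable_coord_sum[OF x]
  have "integrable (m t \<Otimes>\<^sub>M P) (\<lambda>p. coord_sum T x ((\<lambda>(u, s). s(t := u)) p))"
    using int by (subst (asm) distr_substitute[OF t, symmetric]) (simp add: integrable_distr_eq)
  then have "integrable (m t \<Otimes>\<^sub>M P) (case_prod (\<lambda>u s. coord_sum T x (s(t := u))))"
    by (simp add: split_beta')
  then obtain s where "integrable (m t) (\<lambda>u. coord_sum T x (s(t := u)))"
    using eventually_happens'[OF P.ae_filter_bot AE_integrable_snd] by blast
  then have "integrable (m t) (\<lambda>u. coord_sum T x (s(t := u)) - (coord_sum T x s - x t (s t)))"
    by (rule Bochner_Integration.integrable_diff) simp
  then show ?thesis by (simp add: coord_sum_update[OF t])
qed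

text \<open>The summands of a convergent sequence of sums need not converge, because constants can be
  moved between them. They do converge after subtraction of their values at a suitable base
  point.\<close>

lemma AE_limit_of_coord_sums:
  assumes x: "\<And>n t. t \<le> T \<Longrightarrow> x n t \<in> borel_measurable (m t)"
    and [measurable]: "z \<in> borel_measurable P"
    and lim: "AE s in P. (\<lambda>n. coord_sum T (x n) s) \<longlonglongrightarrow> z s"
  obtains y where "\<And>t. t \<le> T \<Longrightarrow> y t \<in> borel_measurable (m t)" "AE s in P. z s = coord_sum T y s"
proof -
  let ?Q = "\<lambda>s. (\<lambda>n. coord_sum T (x n) s) \<longlonglongrightarrow> z s"
  note [measurable] = measurable_coord_sum[OF x]
  have Q: "Measurable.pred P ?Q" by measurable
  have "AE s in P. ?Q s \<and> (\<forall>t\<in>{..T}. AE u in m t. ?Q (s(t := u)))"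
    using lim AE_substitute[OF _ lim Q] by (auto simp: AE_finite_all)
  from eventually_happens'[OF P.ae_filter_bot this]
  obtain a where a: "?Q a" "\<And>t. t \<le> T \<Longrightarrow> AE u in m t. ?Q (a(t := u))"
    by auto
  define y0 where "y0 t u = lim (\<lambda>n. x n t u - x n t (a t))" for t u
  \<comment> \<open>the sums of the subtracted values converge to \<open>z a\<close>; this constant goes to the summand with index 0\<close>
  define y where "y t u = y0 t u + (if t = 0 then z a else 0)" for t u
  have y0: "AE u in m t. (\<lambda>n. x n t u - x n t (a t)) \<longlonglongrightarrow> y0 t u" if t: "t \<le> T" for t
    using a(2)[OF t]
  proof eventually_elim
    case (elim u)
    have "(\<lambda>n. coord_sum T (x n) (a(t := u)) - coord_sum T (x n) a) \<longlonglongrightarrow> z (a(t := u)) - z a"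
      by (intro tendsto_diff elim a(1))
    then have "convergent (\<lambda>n. x n t u - x n t (a t))"
      by (auto simp: coord_sum_update[OF t] convergent_def algebra_simps)
    then show ?case by (simp add: y0_def convergent_LIMSEQ_iff)
  qed
  have y0_meas: "y0 t \<in> borel_measurable (m t)" if t: "t \<le> T" for t
    unfolding y0_def[abs_def] by (intro borel_measurable_lim_metric borel_measurable_diff x[OF t] borel_measurable_const)
  show ?thesis
  proof (rule that)
    show "y t \<in> borel_measurable (m t)" if t: "t \<le> T" for t
      unfolding y_def[abs_def] using y0_meas[OF t] by measurable
    have "AE s in P. \<forall>t\<in>{..T}. (\<lambda>n. x n t (s t) - x n t (a t)) \<longlonglongrightarrow> y0 t (s t)"
      by (intro AE_finite_allI AE_PiM_component[where P = "\<lambda>u. (\<lambda>n. x n _ u - x n _ (a _)) \<longlonglongrightarrow> y0 _ u"] prob y0) auto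
    with lim show "AE s in P. z s = coord_sum T y s"
    proof eventually_elim
      case (elim s)
      have "(\<lambda>n. (\<Sum>t\<le>T. x n t (s t) - x n t (a t)) + coord_sum T (x n) a) \<longlonglongrightarrow> (\<Sum>t\<le>T. y0 t (s t)) + z a"
        using elim(2) by (intro tendsto_add tendsto_sum a(1)) auto
      moreover have "(\<lambda>n. (\<Sum>t\<le>T. x n t (s t) - x n t (a t)) + coord_sum T (x n) a) = (\<lambda>n. coord_sum T (x n) s)"
        by (simp add: coord_sum_def sum_subtractf)
      ultimately have "z s = (\<Sum>t\<le>T. y0 t (s t)) + z a"
        using LIMSEQ_unique[OF elim(1)] by simp
      also have "\<dots> = coord_sum T y s" by (simp add: coord_sum_def y_def sum.distrib)
      finally show ?case .
    qed
  qed
qed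

end

section \<open>Existence of dual minimizers\<close>

lemma integrable_between:
  fixes f :: "'s \<Rightarrow> real"
  assumes "f \<in> borel_measurable M" "integrable M g" "integrable M h"
    and "\<And>s. s \<in> space M \<Longrightarrow> g s \<le> f s" "\<And>s. s \<in> space M \<Longrightarrow> f s \<le> h s"
  shows "integrable M f"
proof (rule Bochner_Integration.integrable_bound)
  show "integrable M (\<lambda>s. \<bar>g s\<bar> + \<bar>h s\<bar>)" using assms by auto
  show "AE s in M. norm (f s) \<le> norm (\<bar>g s\<bar> + \<bar>h s\<bar>)"
    using assms(4,5) by (intro AE_I2) fastforce
qed (rule assms)

lemma linear_coeff_zero:
  fixes a b :: real
  assumes "\<And>d. 0 \<le> d * a + d\<^sup>2 * b" "0 \<le> b"
  shows "a = 0"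
proof -
  define k where "k = a / (b + 1)"
  have a: "a = k * (b + 1)" using assms(2) by (simp add: k_def)
  have "0 \<le> (- k) * a + (- k)\<^sup>2 * b" by (rule assms(1))
  also have "\<dots> = - k\<^sup>2"
    by (simp add: a algebra_simps power2_eq_square)
  finally have "k = 0" by simp
  then show ?thesis by (simp add: a)
qed

text \<open>Convex functions within distance \<open>K\<close> above the negative part. The dual problem is studied
  for all of these together, to cover the negative part itself and its smooth
  approximations. Continuity is needed for passage to the limit.\<close>

definition penalty :: "real \<Rightarrow> (real \<Rightarrow> real) \<Rightarrow> bool" where
  "penalty K q \<longleftrightarrow> continuous_on UNIV q \<and> (\<forall>a b. q ((a + b) / 2) \<le> (q a + q b) / 2) \<and>
     (\<forall>w. neg_part w \<le> q w \<and> q w \<le> neg_part w + K)"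

lemma neg_part_nonneg: "0 \<le> neg_part w"
  by (simp add: neg_part_def)

lemma neg_part_midpoint_convex: "neg_part ((a + b) / 2) \<le> (neg_part a + neg_part b) / 2"
proof -
  have "neg_part (a + b) \<le> neg_part a + neg_part b"
    by (auto simp: neg_part_def)
  moreover have "neg_part (x / 2) = neg_part x / 2" for x
    by (simp add: neg_part_def max_def)
  ultimately show ?thesis by (simp add: divide_right_mono)
qed

lemma penalty_neg_part: "penalty 0 neg_part"
proof -
  have "continuous_on UNIV (\<lambda>w::real. max (- w) 0)" by (intro continuous_intros)
  then have "continuous_on UNIV neg_part" by (simp only: neg_part_def[abs_def])
  then show ?thesis unfolding penalty_def using neg_part_midpoint_convex by auto
qed

lemma penalty_smooth_neg: "0 < \<epsilon> \<Longrightarrow> penalty (\<epsilon> / 2) (smooth_neg \<epsilon>)"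
  unfolding penalty_def
  using smooth_neg_continuous smooth_neg_midpoint_convex smooth_neg_bounds by blast

lemma penalty_measurable: "penalty K q \<Longrightarrow> q \<in> borel_measurable borel"
  by (intro borel_measurable_continuous_onI) (simp add: penalty_def)

text \<open>Cost \<open>c\<close>, capacity \<open>\<phi>\<close>, and the product of the prescribed marginals \<open>m t\<close>.\<close>

locale capacity_transport = product_of_prob_spaces +
  fixes c \<phi> :: "(nat \<Rightarrow> 'a) \<Rightarrow> real" and v :: real
  assumes c_int: "integrable P c" and c_nonneg: "\<And>s. s \<in> space P \<Longrightarrow> 0 \<le> c s"
    and phi_int: "integrable P \<phi>" and v_gt_1: "1 < v"
    and phi_ge: "\<And>s. s \<in> space P \<Longrightarrow> v \<le> \<phi> s"
begin

lemma measurable_c_phi [measurable]: "c \<in> borel_measurable P" "\<phi> \<in> borel_measurable P"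
  using c_int phi_int by auto

lemma phi_nonneg: "s \<in> space P \<Longrightarrow> 0 \<le> \<phi> s"
  using phi_ge v_gt_1 by fastforce

text \<open>The integrand of the dual objective, with the negative part replaced by \<open>q\<close>.\<close>

definition integrand :: "(real \<Rightarrow> real) \<Rightarrow> ((nat \<Rightarrow> 'a) \<Rightarrow> real) \<Rightarrow> (nat \<Rightarrow> 'a) \<Rightarrow> real" where
  "integrand q z s = z s + \<phi> s * q (z s + c s)"

definition dual_value :: "(real \<Rightarrow> real) \<Rightarrow> ((nat \<Rightarrow> 'a) \<Rightarrow> real) \<Rightarrow> real" where
  "dual_value q z = (\<integral>s. integrand q z s \<partial>P)"

text \<open>The functions \<open>s \<mapsto> \<Sum>\<^sub>t x\<^sub>t(s\<^sub>t)\<close> on the product for which the dual objective is finite. The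
  objective depends on the \<open>x\<^sub>t\<close> only through this sum.\<close>

definition potentials :: "((nat \<Rightarrow> 'a) \<Rightarrow> real) set" where
  "potentials = {coord_sum T x | x. (\<forall>t\<le>T. x t \<in> borel_measurable (m t)) \<and>
     integrable P (integrand neg_part (coord_sum T x))}"

text \<open>The real-valued densities with respect to the product measure of the measures that satisfy the
  primal constraints, whether or not they have finite cost.\<close>

definition densities :: "((nat \<Rightarrow> 'a) \<Rightarrow> real) set" where
  "densities = {h \<in> borel_measurable P. (\<forall>s\<in>space P. 0 \<le> h s \<and> h s \<le> \<phi> s) \<and>
     (\<forall>t\<le>T. \<forall>A\<in>sets (m t). (\<integral>s. h s * indicator A (s t) \<partial>P) = measure (m t) A)}"

text \<open>The rate of coercivity of the dual integrand. At \<open>w = z s + c s\<close> the integrand plus \<open>c s\<close> is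
  \<open>w + \<phi> s * q w\<close>, at least \<open>w\<close> for \<open>w \<ge> 0\<close> and at least \<open>(v - 1) * \<bar>w\<bar>\<close> for \<open>w < 0\<close>; this is where
  \<open>v > 1\<close> is used.\<close>

definition \<kappa> :: real where "\<kappa> = min 1 (v - 1)"

lemma kappa_pos: "0 < \<kappa>" using v_gt_1 by (simp add: \<kappa>_def)

lemma integrand_lower:
  assumes s: "s \<in> space P" and q: "\<And>w. neg_part w \<le> q w"
  shows "\<kappa> * \<bar>z s + c s\<bar> - c s \<le> integrand q z s"
proof -
  define w where "w = z s + c s"
  have "\<kappa> * \<bar>w\<bar> \<le> w + v * neg_part w"
  proof (cases "0 \<le> w")
    case True
    then show ?thesis
      using mult_right_mono[of \<kappa> 1 w] by (simp add: neg_part_def \<kappa>_def)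
  next
    case False
    then have "\<kappa> * (- w) \<le> (v - 1) * (- w)"
      by (intro mult_right_mono) (auto simp: \<kappa>_def)
    then show ?thesis using False by (simp add: neg_part_def algebra_simps)
  qed
  also have "\<dots> \<le> w + \<phi> s * neg_part w"
    using phi_ge[OF s] neg_part_nonneg by (intro add_left_mono mult_right_mono)
  also have "\<dots> \<le> w + \<phi> s * q w"
    using q phi_nonneg[OF s] by (intro add_left_mono mult_left_mono)
  finally show ?thesis by (simp add: integrand_def w_def)
qed

lemma integrand_ge: 
  assumes s: "s \<in> space P" and q: "\<And>w. neg_part w \<le> q w"
  shows "- c s \<le> integrand q z s"
proof -
  have "0 \<le> \<kappa> * \<bar>z s + c s\<bar>" using kappa_pos by simp
  then show ?thesis using integrand_lower[OF assms, of z] by linarith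
qed

lemma abs_le_integrand:
  assumes s: "s \<in> space P" and q: "\<And>w. neg_part w \<le> q w"
  shows "\<bar>z s\<bar> \<le> (integrand q z s + c s) / \<kappa> + c s"
proof -
  have "\<bar>z s + c s\<bar> \<le> (integrand q z s + c s) / \<kappa>"
    using integrand_lower[OF s q, of z] kappa_pos by (simp add: pos_le_divide_eq mult.commute)
  then show ?thesis using c_nonneg[OF s] by linarith
qed

lemma measurable_integrand:
  assumes "penalty K q" and [measurable]: "z \<in> borel_measurable P"
  shows "integrand q z \<in> borel_measurable P"
proof -
  have [measurable]: "q \<in> borel_measurable borel" by (rule penalty_measurable[OF assms(1)])
  show ?thesis unfolding integrand_def[abs_def] by measurable
qed

lemma integrable_integrand_iff:
  assumes q: "penalty K q" and z: "z \<in> borel_measurable P"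
  shows "integrable P (integrand q z) \<longleftrightarrow> integrable P (integrand neg_part z)"
proof -
  have d: "integrand neg_part z s \<le> integrand q z s" "integrand q z s \<le> integrand neg_part z s + K * \<phi> s"
    if s: "s \<in> space P" for s
  proof -
    have "neg_part w \<le> q w" "q w \<le> neg_part w + K" for w using q by (auto simp: penalty_def)
    from mult_left_mono[OF this(1)[of "z s + c s"] phi_nonneg[OF s]]
      mult_left_mono[OF this(2)[of "z s + c s"] phi_nonneg[OF s]]
    show "integrand neg_part z s \<le> integrand q z s" "integrand q z s \<le> integrand neg_part z s + K * \<phi> s"
      by (auto simp: integrand_def algebra_simps)
  qed
  show ?thesis
  proof
    assume i: "integrable P (integrand q z)"
    show "integrable P (integrand neg_part z)"
    proof (rule integrable_between[OF measurable_integrand[OF penalty_neg_part z] _ i])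
      show "integrable P (\<lambda>s. integrand q z s - K * \<phi> s)" using i phi_int by simp
    qed (use d in \<open>simp_all add: algebra_simps\<close>)
  next
    assume i: "integrable P (integrand neg_part z)"
    show "integrable P (integrand q z)"
    proof (rule integrable_between[OF measurable_integrand[OF q z] i])
      show "integrable P (\<lambda>s. integrand neg_part z s + K * \<phi> s)" using i phi_int by simp
    qed (use d in simp_all)
  qed
qed

lemma potentialsI:
  assumes "\<And>t. t \<le> T \<Longrightarrow> x t \<in> borel_measurable (m t)"
    "integrable P (integrand neg_part (coord_sum T x))" 
  shows "coord_sum T x \<in> potentials"
  using assms by (auto simp: potentials_def)

lemma potentials_measurable: "z \<in> potentials \<Longrightarrow> z \<in> borel_measurable P"
  by (auto simp: potentials_def measurable_coord_sum)

lemma potentials_integrable_integrand: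
  "z \<in> potentials \<Longrightarrow> penalty K q \<Longrightarrow> integrable P (integrand q z)"
  using integrable_integrand_iff[OF _ potentials_measurable] by (auto simp: potentials_def)

lemma potentials_integrable:
  assumes z: "z \<in> potentials"
  shows "integrable P z"
proof -
  let ?b = "\<lambda>s. (integrand neg_part z s + c s) / \<kappa> + c s"
  have b: "integrable P ?b"
    using potentials_integrable_integrand[OF z penalty_neg_part] c_int by auto
  have "\<bar>z s\<bar> \<le> ?b s" if "s \<in> space P" for s
    using abs_le_integrand[OF that, of neg_part z] by simp
  then have "AE s in P. norm (z s) \<le> norm (?b s)" by (intro AE_I2) fastforce
  with b potentials_measurable[OF z] show ?thesis by (rule Bochner_Integration.integrable_bound)
qed

lemma potentials_integrable_summands:
  assumes "\<And>t. t \<le> T \<Longrightarrow> x t \<in> borel_measurable (m t)" "coord_sum T x \<in> potentials" "t \<le> T"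
  shows "integrable (m t) (x t)"
  using integrable_summand[OF assms(1) potentials_integrable[OF assms(2)] assms(3)] .

lemma integrand_midpoint:
  assumes "penalty K q" "s \<in> space P"
  shows "integrand q (\<lambda>s. (z s + w s) / 2) s \<le> (integrand q z s + integrand q w s) / 2"
proof -
  have eq: "(z s + w s) / 2 + c s = ((z s + c s) + (w s + c s)) / 2" by (simp add: field_simps)
  have "\<phi> s * q ((z s + w s) / 2 + c s) \<le> \<phi> s * ((q (z s + c s) + q (w s + c s)) / 2)"
    unfolding eq using assms(1) phi_nonneg[OF assms(2)] unfolding penalty_def by (intro mult_left_mono) blast+
  then show ?thesis by (simp add: integrand_def algebra_simps add_divide_distrib)
qed

lemma potentials_midpoint:
  assumes z: "z \<in> potentials" and w: "w \<in> potentials"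
  shows "(\<lambda>s. (z s + w s) / 2) \<in> potentials"
proof -
  obtain x where x: "\<And>t. t \<le> T \<Longrightarrow> x t \<in> borel_measurable (m t)" "z = coord_sum T x"
    using z by (auto simp: potentials_def)
  obtain y where y: "\<And>t. t \<le> T \<Longrightarrow> y t \<in> borel_measurable (m t)" "w = coord_sum T y"
    using w by (auto simp: potentials_def)
  have eq: "(\<lambda>s. (z s + w s) / 2) = coord_sum T (\<lambda>t u. (x t u + y t u) / 2)"
    unfolding x(2) y(2) coord_sum_def by (simp add: sum.distrib sum_divide_distrib[symmetric])
  have "integrable P (integrand neg_part (\<lambda>s. (z s + w s) / 2))"
  proof (rule integrable_between)
    show "integrand neg_part (\<lambda>s. (z s + w s) / 2) \<in> borel_measurable P"
      using potentials_measurable[OF z] potentials_measurable[OF w]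
      by (intro measurable_integrand[OF penalty_neg_part] borel_measurable_divide borel_measurable_add borel_measurable_const)
    show "integrable P (\<lambda>s. - c s)" using c_int by auto
    show "integrable P (\<lambda>s. (integrand neg_part z s + integrand neg_part w s) / 2)"
      using potentials_integrable_integrand[OF z penalty_neg_part] potentials_integrable_integrand[OF w penalty_neg_part] by auto
  qed (rule integrand_ge integrand_midpoint[OF penalty_neg_part]; simp)+
  then show ?thesis unfolding eq using x(1) y(1) by (intro potentialsI) auto
qed

lemma zero_potential: "(\<lambda>s. 0) \<in> potentials"
proof -
  have eq: "(\<lambda>s. 0) = coord_sum T (\<lambda>_ _. 0)" by (simp add: fun_eq_iff coord_sum_def)
  have "integrable P (integrand neg_part (\<lambda>s. 0)) \<longleftrightarrow> integrable P (\<lambda>s. 0 :: real)"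
    using c_nonneg by (intro Bochner_Integration.integrable_cong) (auto simp: integrand_def neg_part_def)
  then have "integrable P (integrand neg_part (\<lambda>s. 0))" by simp
  then show ?thesis unfolding eq by (intro potentialsI) auto
qed

lemma dual_minimizer_exists:
  assumes q: "penalty K q"
  obtains z where "z \<in> potentials" "\<And>w. w \<in> potentials \<Longrightarrow> dual_value q z \<le> dual_value q w"
proof -
  have q_ge: "neg_part w \<le> q w" for w using q by (simp add: penalty_def)
  note int = potentials_integrable_integrand[OF _ q]
  have dual_value_ge: "- (\<integral>s. c s \<partial>P) \<le> dual_value q z" if z: "z \<in> potentials" for z
    unfolding dual_value_def integral_minus[symmetric] using int[OF z] c_int
    by (intro integral_mono integrand_ge q_ge) auto
  obtain Z z where Z: "\<And>n. Z n \<in> potentials" and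
    lim_J: "(\<lambda>n. dual_value q (Z n)) \<longlonglongrightarrow> (INF w\<in>potentials. dual_value q w)" and
    z [measurable]: "z \<in> borel_measurable P" and lim: "AE s in P. (\<lambda>n. Z n s) \<longlonglongrightarrow> z s"
  proof (rule P.minimizing_sequence_AE_convergent[where C = potentials and J = "dual_value q"
        and b = "- (\<integral>s. c s \<partial>P)" and \<alpha> = "(\<integral>s. c s \<partial>P) / \<kappa> + (\<integral>s. c s \<partial>P)" and \<beta> = "1 / \<kappa>"])
    show "potentials \<noteq> {}" using zero_potential by auto
    show "dual_value q (\<lambda>s. (z s + w s) / 2) \<le> (dual_value q z + dual_value q w) / 2"
      if z: "z \<in> potentials" and w: "w \<in> potentials" for z w
    proof -
      have "dual_value q (\<lambda>s. (z s + w s) / 2) \<le> (\<integral>s. (integrand q z s + integrand q w s) / 2 \<partial>P)"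
        unfolding dual_value_def using int[OF z] int[OF w] int[OF potentials_midpoint[OF z w]]
        by (intro integral_mono integrand_midpoint[OF q]) auto
      then show ?thesis using int[OF z] int[OF w] by (simp add: dual_value_def)
    qed
    show "(\<integral>s. \<bar>z s\<bar> \<partial>P) \<le> (\<integral>s. c s \<partial>P) / \<kappa> + (\<integral>s. c s \<partial>P) + 1 / \<kappa> * dual_value q z"
      if z: "z \<in> potentials" for z
    proof -
      have "(\<integral>s. \<bar>z s\<bar> \<partial>P) \<le> (\<integral>s. (integrand q z s + c s) / \<kappa> + c s \<partial>P)"
        using potentials_integrable[OF z] int[OF z] c_int
        by (intro integral_mono abs_le_integrand q_ge) auto
      also have "\<dots> = (dual_value q z + (\<integral>s. c s \<partial>P)) / \<kappa> + (\<integral>s. c s \<partial>P)"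
        using int[OF z] c_int by (simp add: dual_value_def)
      finally show ?thesis by (simp add: add_divide_distrib)
    qed
    show "0 \<le> 1 / \<kappa>" using kappa_pos by simp
  qed (auto intro: potentials_integrable potentials_midpoint dual_value_ge)
  have "\<forall>n. \<exists>x. (\<forall>t\<le>T. x t \<in> borel_measurable (m t)) \<and> Z n = coord_sum T x"
    using Z unfolding potentials_def by blast
  from choice[OF this] obtain x where x: "\<And>n t. t \<le> T \<Longrightarrow> x n t \<in> borel_measurable (m t)" "\<And>n. Z n = coord_sum T (x n)"
    by blast
  obtain y where y: "\<And>t. t \<le> T \<Longrightarrow> y t \<in> borel_measurable (m t)" and eq: "AE s in P. z s = coord_sum T y s"
    using AE_limit_of_coord_sums[of x z] x(1) z lim unfolding x(2) by blast
  have int_lim: "AE s in P. (\<lambda>n. integrand q (Z n) s) \<longlonglongrightarrow> integrand q (coord_sum T y) s"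
    using lim eq
  proof eventually_elim
    case (elim s)
    have "isCont q (coord_sum T y s + c s)"
      using q unfolding penalty_def by (simp add: continuous_on_eq_continuous_at)
    moreover have z: "(\<lambda>n. Z n s) \<longlonglongrightarrow> coord_sum T y s" using elim by simp
    ultimately have "(\<lambda>n. q (Z n s + c s)) \<longlonglongrightarrow> q (coord_sum T y s + c s)"
      by (intro isCont_tendsto_compose[where g = q] tendsto_intros)
    then show ?case unfolding integrand_def by (intro tendsto_intros z)
  qed
  have fatou: "integrable P (integrand q (coord_sum T y))"
    "(\<integral>s. integrand q (coord_sum T y) s \<partial>P) \<le> (INF w\<in>potentials. dual_value q w)"
  proof -
    have m: "integrand q (coord_sum T y) \<in> borel_measurable P"
      by (intro measurable_integrand[OF q] measurable_coord_sum y)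
    have "AE s in P. - c s \<le> integrand q (Z n) s" for n
      by (intro AE_I2 integrand_ge q_ge)
    note fatou_lower_bound[OF m Bochner_Integration.integrable_minus[OF c_int] int[OF Z] this int_lim lim_J[unfolded dual_value_def]]
    then show "integrable P (integrand q (coord_sum T y))"
      "(\<integral>s. integrand q (coord_sum T y) s \<partial>P) \<le> (INF w\<in>potentials. dual_value q w)"
      by (simp_all add: dual_value_def)
  qed
  show ?thesis
  proof (rule that)
    show "coord_sum T y \<in> potentials"
      using fatou(1) integrable_integrand_iff[OF q measurable_coord_sum[OF y]] by (intro potentialsI y) auto
    show "dual_value q (coord_sum T y) \<le> dual_value q w" if w: "w \<in> potentials" for w
    proof -
      have "bdd_below (dual_value q ` potentials)"
        by (rule bdd_belowI2[OF dual_value_ge])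
      from cINF_lower[OF this w] show ?thesis using fatou(2) by (simp add: dual_value_def)
    qed
  qed
qed

section \<open>Admissible densities and weak duality\<close>

lemma densitiesI:
  assumes "h \<in> borel_measurable P"
    "\<And>s. s \<in> space P \<Longrightarrow> 0 \<le> h s" "\<And>s. s \<in> space P \<Longrightarrow> h s \<le> \<phi> s"
    "\<And>t A. t \<le> T \<Longrightarrow> A \<in> sets (m t) \<Longrightarrow> (\<integral>s. h s * indicator A (s t) \<partial>P) = measure (m t) A"
  shows "h \<in> densities"
  using assms by (auto simp: densities_def)

lemma densitiesD:
  assumes "h \<in> densities"
  shows "h \<in> borel_measurable P"
    "\<And>s. s \<in> space P \<Longrightarrow> 0 \<le> h s" "\<And>s. s \<in> space P \<Longrightarrow> h s \<le> \<phi> s"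
    "\<And>t A. t \<le> T \<Longrightarrow> A \<in> sets (m t) \<Longrightarrow> (\<integral>s. h s * indicator A (s t) \<partial>P) = measure (m t) A"
  using assms by (auto simp: densities_def)

lemma densities_integrable:
  assumes "h \<in> densities"
  shows "integrable P h"
  by (rule integrable_between[OF densitiesD(1)[OF assms] _ phi_int, of "\<lambda>_. 0"])
     (auto simp: densitiesD[OF assms])

lemma measurable_indicator_coordinate:
  "t \<le> T \<Longrightarrow> A \<in> sets (m t) \<Longrightarrow> (\<lambda>s. indicator A (s t) :: real) \<in> borel_measurable P"
  by (rule measurable_compose[OF measurable_coordinate]) auto

lemma integrable_mult_indicator_coordinate:
  assumes f: "integrable P f" and t: "t \<le> T" "A \<in> sets (m t)"
  shows "integrable P (\<lambda>s. f s * indicator A (s t) :: real)"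
proof (rule Bochner_Integration.integrable_bound[OF f])
  show "(\<lambda>s. f s * indicator A (s t)) \<in> borel_measurable P"
    using f measurable_indicator_coordinate[OF t] by (intro borel_measurable_times) auto
qed (auto simp: indicator_def)

lemma marginals_iff_distr:
  assumes h: "integrable P h" "\<And>s. s \<in> space P \<Longrightarrow> 0 \<le> h s" and t: "t \<le> T"
  shows "distr (density P (\<lambda>s. ennreal (h s))) (m t) (\<lambda>s. s t) = m t \<longleftrightarrow>
    (\<forall>A\<in>sets (m t). (\<integral>s. h s * indicator A (s t) \<partial>P) = measure (m t) A)" (is "?D = m t \<longleftrightarrow> _")
proof -
  interpret mt: prob_space "m t" using prob t by simp
  have [measurable]: "h \<in> borel_measurable P" using h by auto
  have em: "emeasure ?D A = ennreal (\<integral>s. h s * indicator A (s t) \<partial>P)" if A: "A \<in> sets (m t)" for A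
  proof -
    have m': "(\<lambda>s. s t) \<in> density P (\<lambda>s. ennreal (h s)) \<rightarrow>\<^sub>M m t"
      using measurable_coordinate[OF t] by simp
    have vi: "(\<lambda>s. s t) -` A \<inter> space P \<in> sets P"
      using measurable_sets[OF measurable_coordinate[OF t] A] .
    have "emeasure ?D A = (\<integral>\<^sup>+s. ennreal (h s) * indicator ((\<lambda>s. s t) -` A \<inter> space P) s \<partial>P)"
      by (simp add: emeasure_distr[OF m' A] emeasure_density vi)
    also have "\<dots> = (\<integral>\<^sup>+s. ennreal (h s * indicator A (s t)) \<partial>P)"
      by (intro nn_integral_cong) (auto split: split_indicator)
    also have "\<dots> = ennreal (\<integral>s. h s * indicator A (s t) \<partial>P)"
      using h(2) by (intro nn_integral_eq_integral integrable_mult_indicator_coordinate h t A AE_I2) auto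
    finally show ?thesis .
  qed
  have nn: "0 \<le> (\<integral>s. h s * indicator A (s t) \<partial>P)" for A
    using h(2) by (intro integral_nonneg_AE AE_I2) auto
  show ?thesis
  proof
    assume D: "?D = m t"
    show "\<forall>A\<in>sets (m t). (\<integral>s. h s * indicator A (s t) \<partial>P) = measure (m t) A"
    proof
      fix A assume A: "A \<in> sets (m t)"
      show "(\<integral>s. h s * indicator A (s t) \<partial>P) = measure (m t) A"
        using em[OF A] nn[of A] by (simp add: D mt.emeasure_eq_measure)
    qed
  next
    assume "\<forall>A\<in>sets (m t). (\<integral>s. h s * indicator A (s t) \<partial>P) = measure (m t) A"
    then show "?D = m t"
      by (intro measure_eqI) (simp_all add: em mt.emeasure_eq_measure)
  qed
qed

lemma densities_distr:
  assumes "h \<in> densities" "t \<le> T"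
  shows "distr (density P (\<lambda>s. ennreal (h s))) (m t) (\<lambda>s. s t) = m t"
  using marginals_iff_distr[OF densities_integrable[OF assms(1)] _ assms(2)] densitiesD[OF assms(1)] assms(2) by auto

lemma density_integral_coordinate:
  fixes f :: "'a \<Rightarrow> real"
  assumes h: "h \<in> densities" and t: "t \<le> T" and f: "integrable (m t) f"
  shows "integrable P (\<lambda>s. h s * f (s t))" "(\<integral>s. h s * f (s t) \<partial>P) = (\<integral>u. f u \<partial>m t)"
proof -
  let ?N = "density P (\<lambda>s. ennreal (h s))"
  note hm [measurable] = densitiesD(1)[OF h]
  have hAE: "AE s in P. 0 \<le> h s" using densitiesD(2)[OF h] by (intro AE_I2)
  have m': "(\<lambda>s. s t) \<in> ?N \<rightarrow>\<^sub>M m t" using measurable_coordinate[OF t] by simp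
  have fm: "f \<in> borel_measurable (m t)" using f by auto
  have fm': "(\<lambda>s. f (s t)) \<in> borel_measurable P" by (rule measurable_compose[OF measurable_coordinate[OF t] fm])
  have "integrable ?N (\<lambda>s. f (s t))"
    using f integrable_distr_eq[OF m' fm] by (simp add: densities_distr[OF h t])
  then show "integrable P (\<lambda>s. h s * f (s t))"
    using integrable_real_density[OF hm hAE fm'] by simp
  have "(\<integral>u. f u \<partial>m t) = (\<integral>s. f (s t) \<partial>?N)"
    using integral_distr[OF m' fm] by (simp add: densities_distr[OF h t])
  then show "(\<integral>s. h s * f (s t) \<partial>P) = (\<integral>u. f u \<partial>m t)"
    using integral_real_density[OF hm hAE fm'] by simp
qed

lemma one_in_densities: "(\<lambda>s. 1) \<in> densities"
proof (rule densitiesI)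
  fix t A assume t: "t \<le> T" and A: "A \<in> sets (m t)"
  have "(\<integral>s. 1 * indicator A (s t) \<partial>P) = (\<integral>u. (indicator A u :: real) \<partial>distr P (m t) (\<lambda>s. s t))"
    using A by (subst integral_distr[OF measurable_coordinate[OF t]]) auto
  also have "distr P (m t) (\<lambda>s. s t) = m t"
    using prob t by (intro distr_PiM_component) auto
  finally show "(\<integral>s. 1 * indicator A (s t) \<partial>P) = measure (m t) A" using A by simp
qed (use phi_ge v_gt_1 in \<open>force+\<close>)

lemma potential_integral_density:
  assumes z: "z \<in> potentials" and h: "h \<in> densities"
  shows "integrable P (\<lambda>s. h s * z s)" "(\<integral>s. h s * z s \<partial>P) = (\<integral>s. z s \<partial>P)"
proof -
  obtain x where x: "\<And>t. t \<le> T \<Longrightarrow> x t \<in> borel_measurable (m t)" "z = coord_sum T x"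
    using z by (auto simp: potentials_def)
  have xi: "integrable (m t) (x t)" if "t \<le> T" for t
    using potentials_integrable_summands[OF x(1) _ that] z x(2) by auto
  have gen: "integrable P (\<lambda>s. k s * z s) \<and> (\<integral>s. k s * z s \<partial>P) = (\<Sum>t\<le>T. \<integral>u. x t u \<partial>m t)"
    if k: "k \<in> densities" for k
  proof -
    have eq: "(\<lambda>s. k s * z s) = (\<lambda>s. \<Sum>t\<le>T. k s * x t (s t))"
      by (simp add: x(2) coord_sum_def sum_distrib_left)
    show ?thesis unfolding eq
      using density_integral_coordinate[OF k _ xi] by (auto simp: Bochner_Integration.integral_sum)
  qed
  show "integrable P (\<lambda>s. h s * z s)" "(\<integral>s. h s * z s \<partial>P) = (\<integral>s. z s \<partial>P)"
    using gen[OF h] gen[OF one_in_densities] by auto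
qed

text \<open>The pointwise duality gap of a potential and a density. It equals
  \<open>(\<phi> - h) (z + c)\<^sup>- + h (z + c)\<^sup>+\<close>, so it is nonnegative, and it vanishes exactly under complementary
  slackness.\<close>

definition slackness_gap :: "((nat \<Rightarrow> 'a) \<Rightarrow> real) \<Rightarrow> ((nat \<Rightarrow> 'a) \<Rightarrow> real) \<Rightarrow> (nat \<Rightarrow> 'a) \<Rightarrow> real" where
  "slackness_gap z h s = \<phi> s * neg_part (z s + c s) + h s * (z s + c s)"

lemma slackness_gap_nonneg:
  assumes "h \<in> densities" "s \<in> space P"
  shows "0 \<le> slackness_gap z h s"
proof (cases "0 \<le> z s + c s")
  case True
  then show ?thesis using densitiesD(2)[OF assms] by (simp add: slackness_gap_def neg_part_def)
next
  case False
  then have "0 \<le> (\<phi> s - h s) * (- (z s + c s))"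
    using densitiesD(3)[OF assms] by (intro mult_nonneg_nonneg) auto
  then show ?thesis using False by (simp add: slackness_gap_def neg_part_def algebra_simps)
qed

lemma slackness_gap_eq_0_iff:
  assumes "h \<in> densities" "s \<in> space P"
  shows "slackness_gap z h s = 0 \<longleftrightarrow> (- z s < c s \<longrightarrow> h s = 0) \<and> (- z s > c s \<longrightarrow> h s = \<phi> s)"
proof -
  consider "z s + c s > 0" | "z s + c s = 0" | "z s + c s < 0" by linarith
  then show ?thesis
  proof cases
    case 3
    have "slackness_gap z h s = (h s - \<phi> s) * (z s + c s)"
      using 3 by (simp add: slackness_gap_def neg_part_def algebra_simps)
    then show ?thesis using 3 by auto
  qed (auto simp: slackness_gap_def neg_part_def)
qed

lemma weak_duality:
  assumes z: "z \<in> potentials" and h: "h \<in> densities" and ch: "integrable P (\<lambda>s. c s * h s)"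
  shows "integrable P (slackness_gap z h)"
    "dual_value neg_part z + (\<integral>s. c s * h s \<partial>P) = (\<integral>s. slackness_gap z h s \<partial>P)"
proof -
  note i = potentials_integrable_integrand[OF z penalty_neg_part] potentials_integrable[OF z]
    potential_integral_density[OF z h]
  have eq: "slackness_gap z h = (\<lambda>s. integrand neg_part z s - z s + h s * z s + c s * h s)"
    by (simp add: fun_eq_iff slackness_gap_def integrand_def algebra_simps)
  show "integrable P (slackness_gap z h)" unfolding eq using i ch by auto
  show "dual_value neg_part z + (\<integral>s. c s * h s \<partial>P) = (\<integral>s. slackness_gap z h s \<partial>P)"
    unfolding eq dual_value_def using i ch by simp
qed

section \<open>Strong duality\<close>

text \<open>First-order condition. A minimizer of the smoothed dual objective is stationary under
  perturbation of one summand by a multiple of the indicator of \<open>A\<close>, and this says that the density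
  \<open>\<phi> * smooth_neg_slope \<epsilon> (z + c)\<close> gives \<open>{s. s t \<in> A}\<close> the mass prescribed by \<open>m t\<close>. The quadratic
  upper bound for \<^const>\<open>smooth_neg\<close> replaces differentiation under the integral.\<close>

lemma smooth_dual_stationary:
  assumes eps: "0 < \<epsilon>" and z: "z \<in> potentials"
    and min: "\<And>w. w \<in> potentials \<Longrightarrow> dual_value (smooth_neg \<epsilon>) z \<le> dual_value (smooth_neg \<epsilon>) w"
  shows "(\<lambda>s. \<phi> s * smooth_neg_slope \<epsilon> (z s + c s)) \<in> densities" (is "?h \<in> _")
proof (rule densitiesI)
  let ?q = "smooth_neg \<epsilon>"
  note [measurable] = potentials_measurable[OF z]
  show hm: "?h \<in> borel_measurable P" by measurable
  show h0: "0 \<le> ?h s" if "s \<in> space P" for s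
    using phi_nonneg[OF that] smooth_neg_slope_bounds by simp
  show h1: "?h s \<le> \<phi> s" if "s \<in> space P" for s
    using phi_nonneg[OF that] smooth_neg_slope_bounds by (simp add: mult_left_le)
  have hint: "integrable P ?h"
    by (rule integrable_between[OF hm _ phi_int, of "\<lambda>_. 0"]) (use h0 h1 in auto)
  fix t A assume t: "t \<le> T" and A: "A \<in> sets (m t)"
  let ?y = "\<lambda>s. indicator A (s t) :: real"
  have ym: "?y \<in> borel_measurable P" by (rule measurable_indicator_coordinate[OF t A])
  have yint: "integrable P ?y"
    using integrable_mult_indicator_coordinate[of "\<lambda>_. 1", OF _ t A] by simp
  have hyint: "integrable P (\<lambda>s. ?h s * ?y s)"
    by (rule integrable_mult_indicator_coordinate[OF hint t A])
  have q: "penalty (\<epsilon> / 2) ?q" using eps by (rule penalty_smooth_neg)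
  have zint: "integrable P (integrand ?q z)" by (rule potentials_integrable_integrand[OF z q])
  have up: "integrand ?q (\<lambda>s. z s + d * ?y s) s
      \<le> integrand ?q z s + d * (?y s - ?h s * ?y s) + d\<^sup>2 * (\<phi> s / (4 * \<epsilon>))"
    if s: "s \<in> space P" for s d
  proof -
    define w where "w = z s + c s"
    have "?q (w + d * ?y s) \<le> ?q w - smooth_neg_slope \<epsilon> w * (d * ?y s) + (d * ?y s)\<^sup>2 / (4 * \<epsilon>)"
      by (rule smooth_neg_tangent[OF eps])
    also have "\<dots> \<le> ?q w - smooth_neg_slope \<epsilon> w * (d * ?y s) + d\<^sup>2 / (4 * \<epsilon>)"
      using eps by (intro add_left_mono divide_right_mono) (auto split: split_indicator)
    finally have "\<phi> s * ?q (w + d * ?y s) \<le> \<phi> s * (?q w - smooth_neg_slope \<epsilon> w * (d * ?y s) + d\<^sup>2 / (4 * \<epsilon>))"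
      using phi_nonneg[OF s] by (rule mult_left_mono)
    moreover have "integrand ?q (\<lambda>s. z s + d * ?y s) s = z s + d * ?y s + \<phi> s * ?q (w + d * ?y s)"
      by (simp add: integrand_def w_def add_ac)
    moreover have "integrand ?q z s = z s + \<phi> s * ?q w"
      by (simp add: integrand_def w_def)
    ultimately show ?thesis
      unfolding w_def[symmetric] by (simp add: algebra_simps)
  qed
  have shift: "(\<lambda>s. z s + d * ?y s) \<in> potentials" for d
  proof -
    obtain x where x: "\<And>t. t \<le> T \<Longrightarrow> x t \<in> borel_measurable (m t)" "z = coord_sum T x"
      using z by (auto simp: potentials_def)
    define x' where "x' i u = x i u + (if i = t then d * indicator A u else 0)" for i u
    have x': "x' i \<in> borel_measurable (m i)" if "i \<le> T" for i
      unfolding x'_def using x(1)[OF that] A by (cases "i = t") auto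
    have "coord_sum T x' s = coord_sum T x s + d * ?y s" for s
    proof -
      have "(\<Sum>i\<le>T. if i = t then d * indicator A (s i) else 0 :: real) = d * ?y s"
        using t by simp
      then show ?thesis by (simp add: coord_sum_def x'_def sum.distrib)
    qed
    then have eq: "(\<lambda>s. z s + d * ?y s) = coord_sum T x'" by (simp add: fun_eq_iff x(2))
    have m': "(\<lambda>s. z s + d * ?y s) \<in> borel_measurable P" using ym by measurable
    have "integrable P (integrand ?q (\<lambda>s. z s + d * ?y s))"
    proof (rule integrable_between[OF measurable_integrand[OF q m']])
      show "integrable P (\<lambda>s. - c s)" using c_int by simp
      show "integrable P (\<lambda>s. integrand ?q z s + d * (?y s - ?h s * ?y s) + d\<^sup>2 * (\<phi> s / (4 * \<epsilon>)))"
        using zint yint hyint phi_int by simp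
      show "- c s \<le> integrand ?q (\<lambda>s. z s + d * ?y s) s" if "s \<in> space P" for s
        by (rule integrand_ge[OF that smooth_neg_bounds(1)[OF eps]])
    qed (rule up)
    then have "integrable P (integrand neg_part (coord_sum T x'))"
      using integrable_integrand_iff[OF q m'] by (simp add: eq)
    then show ?thesis unfolding eq by (intro potentialsI x') auto
  qed
  have "(\<integral>s. ?y s \<partial>P) - (\<integral>s. ?h s * ?y s \<partial>P) = 0"
  proof (rule linear_coeff_zero)
    fix d
    have "dual_value ?q (\<lambda>s. z s + d * ?y s) \<le>
        (\<integral>s. integrand ?q z s + d * (?y s - ?h s * ?y s) + d\<^sup>2 * (\<phi> s / (4 * \<epsilon>)) \<partial>P)"
      unfolding dual_value_def using zint yint hyint phi_int up
      by (intro integral_mono potentials_integrable_integrand[OF shift q]) simp_all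
    also have "\<dots> = dual_value ?q z + d * ((\<integral>s. ?y s \<partial>P) - (\<integral>s. ?h s * ?y s \<partial>P)) + d\<^sup>2 * ((\<integral>s. \<phi> s \<partial>P) / (4 * \<epsilon>))"
      unfolding dual_value_def using zint yint hyint phi_int by simp
    finally show "0 \<le> d * ((\<integral>s. ?y s \<partial>P) - (\<integral>s. ?h s * ?y s \<partial>P)) + d\<^sup>2 * ((\<integral>s. \<phi> s \<partial>P) / (4 * \<epsilon>))"
      using min[OF shift[of d]] by linarith
    have "0 \<le> (\<integral>s. \<phi> s \<partial>P)" using phi_nonneg by (intro integral_nonneg_AE AE_I2)
    then show "0 \<le> (\<integral>s. \<phi> s \<partial>P) / (4 * \<epsilon>)" using eps by simp
  qed
  then show "(\<integral>s. ?h s * ?y s \<partial>P) = measure (m t) A"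
    using densitiesD(4)[OF one_in_densities t A] by simp
qed

lemma approximate_duality:
  assumes eps: "0 < \<epsilon>"
  obtains z h where "z \<in> potentials" "h \<in> densities" "integrable P (\<lambda>s. c s * h s)"
    "dual_value neg_part z + (\<integral>s. c s * h s \<partial>P) \<le> \<epsilon> / 2 * (\<integral>s. \<phi> s \<partial>P)"
proof -
  let ?q = "smooth_neg \<epsilon>"
  have q: "penalty (\<epsilon> / 2) ?q" using eps by (rule penalty_smooth_neg)
  obtain z where z: "z \<in> potentials" and min: "\<And>w. w \<in> potentials \<Longrightarrow> dual_value ?q z \<le> dual_value ?q w"
    using dual_minimizer_exists[OF q] by blast
  define h where "h s = \<phi> s * smooth_neg_slope \<epsilon> (z s + c s)" for s
  have h: "h \<in> densities" unfolding h_def by (rule smooth_dual_stationary[OF eps z min])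
  have gap: "0 \<le> \<phi> s * ?q (z s + c s) + h s * (z s + c s)"
     "\<phi> s * ?q (z s + c s) + h s * (z s + c s) \<le> \<epsilon> / 2 * \<phi> s" if s: "s \<in> space P" for s
    using mult_left_mono[OF smooth_neg_gap(1)[OF eps, of "z s + c s"] phi_nonneg[OF s]]
      mult_left_mono[OF smooth_neg_gap(2)[OF eps, of "z s + c s"] phi_nonneg[OF s]]
    by (simp_all add: h_def algebra_simps)
  note i = potentials_integrable_integrand[OF z q] potentials_integrable[OF z]
    potential_integral_density(1)[OF z h]
  \<comment> \<open>\<open>c * \<phi>\<close> need not be integrable; integrability of \<open>c * h\<close> follows from the bounds on the gap\<close>
  have "integrable P (\<lambda>s. \<phi> s * ?q (z s + c s) + h s * (z s + c s))"
  proof (rule integrable_between)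
    have [measurable]: "z \<in> borel_measurable P" "h \<in> borel_measurable P" "?q \<in> borel_measurable borel"
      using potentials_measurable[OF z] densitiesD(1)[OF h] penalty_measurable[OF q] by auto
    show "(\<lambda>s. \<phi> s * ?q (z s + c s) + h s * (z s + c s)) \<in> borel_measurable P" by measurable
    show "integrable P (\<lambda>s. 0 :: real)" by simp
    show "integrable P (\<lambda>s. \<epsilon> / 2 * \<phi> s)" using phi_int by simp
  qed (use gap in auto)
  then have "integrable P (\<lambda>s. (\<phi> s * ?q (z s + c s) + h s * (z s + c s)) - (integrand ?q z s - z s) - h s * z s)"
    using i by (intro Bochner_Integration.integrable_diff) auto
  then have ch: "integrable P (\<lambda>s. c s * h s)"
    by (simp add: integrand_def algebra_simps)
  have "slackness_gap z h s \<le> \<epsilon> / 2 * \<phi> s" if s: "s \<in> space P" for s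
    using gap(2)[OF s] mult_left_mono[OF smooth_neg_bounds(1)[OF eps, of "z s + c s"] phi_nonneg[OF s]]
    by (simp add: slackness_gap_def)
  then have "(\<integral>s. slackness_gap z h s \<partial>P) \<le> (\<integral>s. \<epsilon> / 2 * \<phi> s \<partial>P)"
    using weak_duality(1)[OF z h ch] phi_int by (intro integral_mono) auto
  then show ?thesis
    using that[OF z h ch] weak_duality(2)[OF z h ch] by simp
qed

lemma primal_minimizer_exists:
  obtains h where "h \<in> densities" "integrable P (\<lambda>s. c s * h s)"
    "\<And>k. k \<in> densities \<Longrightarrow> integrable P (\<lambda>s. c s * k s) \<Longrightarrow> (\<integral>s. c s * h s \<partial>P) \<le> (\<integral>s. c s * k s \<partial>P)"
proof -
  define H where "H = {h \<in> densities. integrable P (\<lambda>s. c s * h s)}"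
  define J where "J h = (\<integral>s. c s * h s \<partial>P)" for h
  have HD: "h \<in> densities" "integrable P (\<lambda>s. c s * h s)" if "h \<in> H" for h using that by (auto simp: H_def)
  have J_nonneg: "0 \<le> J h" if "h \<in> H" for h
    unfolding J_def using c_nonneg densitiesD(2)[OF HD(1)[OF that]] by (intro integral_nonneg_AE AE_I2) simp
  obtain Z z where Z: "\<And>n. Z n \<in> H" and lim_J: "(\<lambda>n. J (Z n)) \<longlonglongrightarrow> (INF h\<in>H. J h)"
    and z [measurable]: "z \<in> borel_measurable P" and lim: "AE s in P. (\<lambda>n. Z n s) \<longlonglongrightarrow> z s"
  proof (rule P.minimizing_sequence_AE_convergent[where C = H and J = J and b = 0
        and \<alpha> = "\<integral>s. \<phi> s \<partial>P" and \<beta> = 0])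
    show "H \<noteq> {}" using one_in_densities c_int by (auto simp: H_def)
    show "integrable P h" if "h \<in> H" for h using densities_integrable HD(1)[OF that] by simp
    show "(\<lambda>s. (h s + k s) / 2) \<in> H" if h: "h \<in> H" and k: "k \<in> H" for h k
    proof -
      note h' = densitiesD[OF HD(1)[OF h]] and k' = densitiesD[OF HD(1)[OF k]]
      have "(\<lambda>s. (h s + k s) / 2) \<in> densities"
      proof (rule densitiesI)
        show "(\<lambda>s. (h s + k s) / 2) \<in> borel_measurable P" using h'(1) k'(1) by simp
        show "0 \<le> (h s + k s) / 2" if "s \<in> space P" for s using h'(2)[OF that] k'(2)[OF that] by simp
        show "(h s + k s) / 2 \<le> \<phi> s" if "s \<in> space P" for s using h'(3)[OF that] k'(3)[OF that] by simp
        fix t A assume t: "t \<le> T" and A: "A \<in> sets (m t)"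
        have "(\<integral>s. (h s + k s) / 2 * indicator A (s t) \<partial>P) =
          (\<integral>s. (h s * indicator A (s t) + k s * indicator A (s t)) / 2 \<partial>P)"
          by (simp add: field_simps)
        also have "\<dots> = measure (m t) A"
          using integrable_mult_indicator_coordinate[OF densities_integrable[OF HD(1)[OF h]] t A]
            integrable_mult_indicator_coordinate[OF densities_integrable[OF HD(1)[OF k]] t A]
          by (simp add: h'(4)[OF t A] k'(4)[OF t A])
        finally show "(\<integral>s. (h s + k s) / 2 * indicator A (s t) \<partial>P) = measure (m t) A" .
      qed
      moreover have "integrable P (\<lambda>s. (c s * h s + c s * k s) / 2)" using HD(2)[OF h] HD(2)[OF k] by simp
      ultimately show ?thesis by (simp add: H_def algebra_simps)
    qed
    show "J (\<lambda>s. (h s + k s) / 2) \<le> (J h + J k) / 2" if h: "h \<in> H" and k: "k \<in> H" for h k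
    proof -
      have "J (\<lambda>s. (h s + k s) / 2) = (\<integral>s. (c s * h s + c s * k s) / 2 \<partial>P)"
        by (simp add: J_def algebra_simps)
      also have "\<dots> = (J h + J k) / 2" using HD(2)[OF h] HD(2)[OF k] by (simp add: J_def)
      finally show ?thesis by simp
    qed
    show "(\<integral>s. \<bar>h s\<bar> \<partial>P) \<le> (\<integral>s. \<phi> s \<partial>P) + 0 * J h" if h: "h \<in> H" for h
      using densitiesD[OF HD(1)[OF h]] densities_integrable[OF HD(1)[OF h]] phi_int
      by (simp, intro integral_mono) auto
  qed (use J_nonneg in auto)
  \<comment> \<open>truncation makes the bounds \<open>0 \<le> h \<le> \<phi>\<close> hold everywhere, not only almost everywhere\<close>
  define h where "h s = max 0 (min (\<phi> s) (z s))" for s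
  have lim_h: "AE s in P. (\<lambda>n. Z n s) \<longlonglongrightarrow> h s"
    using lim AE_space
  proof eventually_elim
    case (elim s)
    have "0 \<le> z s"
      by (rule LIMSEQ_le_const[OF elim(1)]) (use densitiesD(2)[OF HD(1)[OF Z] elim(2)] in auto)
    moreover have "z s \<le> \<phi> s"
      by (rule LIMSEQ_le_const2[OF elim(1)]) (use densitiesD(3)[OF HD(1)[OF Z] elim(2)] in auto)
    ultimately show ?case using elim(1) by (simp add: h_def)
  qed
  have h: "h \<in> densities"
  proof (rule densitiesI)
    show hm: "h \<in> borel_measurable P" unfolding h_def[abs_def] by measurable
    show "0 \<le> h s" if "s \<in> space P" for s by (simp add: h_def)
    show "h s \<le> \<phi> s" if "s \<in> space P" for s using phi_nonneg[OF that] by (simp add: h_def)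
    fix t A assume t: "t \<le> T" and A: "A \<in> sets (m t)"
    note Am = measurable_indicator_coordinate[OF t A]
    have "(\<lambda>n. \<integral>s. Z n s * indicator A (s t) \<partial>P) \<longlonglongrightarrow> (\<integral>s. h s * indicator A (s t) \<partial>P)"
    proof (rule integral_dominated_convergence[OF _ _ phi_int])
      show "(\<lambda>s. h s * indicator A (s t)) \<in> borel_measurable P" using hm Am by simp
      show "(\<lambda>s. Z n s * indicator A (s t)) \<in> borel_measurable P" for n
        using densitiesD(1)[OF HD(1)[OF Z]] Am by simp
      show "AE s in P. (\<lambda>n. Z n s * indicator A (s t)) \<longlonglongrightarrow> h s * indicator A (s t)"
        using lim_h by eventually_elim (intro tendsto_intros)
      show "AE s in P. norm (Z n s * indicator A (s t)) \<le> \<phi> s" for n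
        using densitiesD(2,3)[OF HD(1)[OF Z]] phi_nonneg by (intro AE_I2) (auto split: split_indicator)
    qed
    then show "(\<integral>s. h s * indicator A (s t) \<partial>P) = measure (m t) A"
      using densitiesD(4)[OF HD(1)[OF Z] t A] by (simp add: LIMSEQ_const_iff)
  qed
  have m': "(\<lambda>s. c s * h s) \<in> borel_measurable P" using densitiesD(1)[OF h] by simp
  have ge: "AE s in P. 0 \<le> c s * Z n s" for n
    using densitiesD(2)[OF HD(1)[OF Z]] c_nonneg by (intro AE_I2) simp
  have lim': "AE s in P. (\<lambda>n. c s * Z n s) \<longlonglongrightarrow> c s * h s"
    using lim_h by eventually_elim (intro tendsto_intros)
  have zi: "integrable P (\<lambda>_. 0 :: real)" by simp
  note fatou = fatou_lower_bound[OF m' zi HD(2)[OF Z] ge lim' lim_J[unfolded J_def]]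
  show ?thesis
  proof (rule that[OF h fatou(1)])
    fix k assume "k \<in> densities" "integrable P (\<lambda>s. c s * k s)"
    then have k: "k \<in> H" by (simp add: H_def)
    have "(INF h\<in>H. J h) \<le> J k"
      by (rule cINF_lower[OF bdd_belowI2[of _ 0] k]) (rule J_nonneg)
    then show "(\<integral>s. c s * h s \<partial>P) \<le> (\<integral>s. c s * k s \<partial>P)"
      using fatou(2) by (simp add: J_def)
  qed
qed

lemma strong_duality:
  obtains z h where "z \<in> potentials" "h \<in> densities" "integrable P (\<lambda>s. c s * h s)"
    "dual_value neg_part z = - (\<integral>s. c s * h s \<partial>P)"
proof -
  obtain z where z: "z \<in> potentials"
    and zmin: "\<And>w. w \<in> potentials \<Longrightarrow> dual_value neg_part z \<le> dual_value neg_part w"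
    using dual_minimizer_exists[OF penalty_neg_part] by blast
  obtain h where h: "h \<in> densities" "integrable P (\<lambda>s. c s * h s)"
    and hmin: "\<And>k. k \<in> densities \<Longrightarrow> integrable P (\<lambda>s. c s * k s) \<Longrightarrow> (\<integral>s. c s * h s \<partial>P) \<le> (\<integral>s. c s * k s \<partial>P)"
    using primal_minimizer_exists by blast
  let ?g = "dual_value neg_part z + (\<integral>s. c s * h s \<partial>P)"
  have "0 \<le> ?g"
    unfolding weak_duality(2)[OF z h] by (intro integral_nonneg_AE AE_I2 slackness_gap_nonneg[OF h(1)])
  moreover have "?g \<le> 0 + e" if e: "0 < e" for e
  proof -
    let ?I = "\<integral>s. \<phi> s \<partial>P"
    have I: "0 \<le> ?I" using phi_nonneg by (intro integral_nonneg_AE AE_I2)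
    \<comment> \<open>adding 1 keeps the denominator positive\<close>
    define \<epsilon> where "\<epsilon> = 2 * e / (?I + 1)"
    have "0 < \<epsilon>" using e I by (simp add: \<epsilon>_def)
    then obtain w k where wk: "w \<in> potentials" "k \<in> densities" "integrable P (\<lambda>s. c s * k s)"
      "dual_value neg_part w + (\<integral>s. c s * k s \<partial>P) \<le> \<epsilon> / 2 * ?I"
      using approximate_duality by blast
    have "\<epsilon> / 2 * ?I \<le> \<epsilon> / 2 * (?I + 1)" using \<open>0 < \<epsilon>\<close> by simp
    also have "\<dots> = e"
    proof -
      have "2 * e / k / 2 * k = e" if "k \<noteq> 0" for k :: real using that by simp
      from this[of "?I + 1"] show ?thesis unfolding \<epsilon>_def using I by linarith
    qed
    finally show ?thesis using wk(4) zmin[OF wk(1)] hmin[OF wk(2,3)] by linarith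
  qed
  then have "?g \<le> 0" by (rule field_le_epsilon)
  ultimately show ?thesis using that[OF z h] by linarith
qed

end

section \<open>Extended-real objectives and the Radon-Nikodym derivative\<close>

lemma ext_integral_eq_integral:
  assumes f: "integrable M f"
  shows "ext_integral M f = ereal (\<integral>s. f s \<partial>M)"
proof -
  have fin: "(\<integral>\<^sup>+s. ennreal (f s) \<partial>M) < \<infinity>" "(\<integral>\<^sup>+s. ennreal (- f s) \<partial>M) < \<infinity>"
    using f by (auto simp: real_integrable_def less_top)
  have e: "enn2ereal x = ereal (enn2real x)" if "x < \<infinity>" for x
    using that by (cases x) auto
  have "integrable M (\<lambda>s. max (f s) 0)" using f by auto
  then show ?thesis
    by (simp add: ext_integral_def e[OF fin(1)] e[OF fin(2)] real_lebesgue_integral_def[OF f])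
qed

lemma ext_integral_less_infinity_imp_integrable:
  assumes f: "f \<in> borel_measurable M" and g: "integrable M g"
    and ge: "\<And>s. s \<in> space M \<Longrightarrow> g s \<le> f s" and fin: "ext_integral M f < \<infinity>"
  shows "integrable M f"
proof (rule integrable_between[OF f g])
  show "integrable M (\<lambda>s. max (f s) 0)"
    using fin by (auto simp: ext_integral_def split: if_splits)
qed (auto intro: ge)

lemma optimal_iff:
  "optimal C J z \<longleftrightarrow> feasible C J z \<and> (\<forall>z'\<in>C. J z \<le> J z')"
  unfolding optimal_def feasible_def
  by (auto intro: INF_lower antisym INF_greatest)

context capacity_transport
begin

lemma obj_B_potential:
  assumes "coord_sum T x \<in> potentials"
  shows "obj_B T P c \<phi> x = ereal (dual_value neg_part (coord_sum T x))"
  using ext_integral_eq_integral[OF potentials_integrable_integrand[OF assms penalty_neg_part]]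
  by (simp add: obj_B_def dual_value_def integrand_def[abs_def])

lemma obj_B_less_infinity_iff:
  assumes x: "\<And>t. t \<le> T \<Longrightarrow> x t \<in> borel_measurable (m t)"
  shows "obj_B T P c \<phi> x < \<infinity> \<longleftrightarrow> coord_sum T x \<in> potentials"
proof
  assume fin: "obj_B T P c \<phi> x < \<infinity>"
  have "integrable P (integrand neg_part (coord_sum T x))"
  proof (rule ext_integral_less_infinity_imp_integrable)
    show "integrand neg_part (coord_sum T x) \<in> borel_measurable P"
      by (intro measurable_integrand[OF penalty_neg_part] measurable_coord_sum x)
    show "integrable P (\<lambda>s. - c s)" using c_int by simp
    show "- c s \<le> integrand neg_part (coord_sum T x) s" if "s \<in> space P" for s
      by (rule integrand_ge[OF that]) simp
    show "ext_integral P (integrand neg_part (coord_sum T x)) < \<infinity>"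
      using fin by (simp add: obj_B_def integrand_def[abs_def])
  qed
  with x show "coord_sum T x \<in> potentials" by (rule potentialsI)
qed (simp add: obj_B_potential)

lemma obj_A_density:
  assumes h: "h \<in> densities"
  shows "integrable P (\<lambda>s. c s * h s) \<Longrightarrow> obj_A c (density P (\<lambda>s. ennreal (h s))) = ereal (\<integral>s. c s * h s \<partial>P)"
    and "obj_A c (density P (\<lambda>s. ennreal (h s))) < \<infinity> \<longleftrightarrow> integrable P (\<lambda>s. c s * h s)"
proof -
  let ?N = "density P (\<lambda>s. ennreal (h s))"
  note hm = densitiesD(1)[OF h]
  have hAE: "AE s in P. 0 \<le> h s" using densitiesD(2)[OF h] by (intro AE_I2)
  have eq: "integrable ?N c \<longleftrightarrow> integrable P (\<lambda>s. c s * h s)"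
    using integrable_real_density[OF hm hAE measurable_c_phi(1)] by (simp add: mult.commute)
  show val: "obj_A c ?N = ereal (\<integral>s. c s * h s \<partial>P)" if "integrable P (\<lambda>s. c s * h s)"
    using that eq integral_real_density[OF hm hAE measurable_c_phi(1)]
    by (simp add: obj_A_def ext_integral_eq_integral mult.commute)
  show "obj_A c ?N < \<infinity> \<longleftrightarrow> integrable P (\<lambda>s. c s * h s)"
  proof
    assume fin: "obj_A c ?N < \<infinity>"
    have "integrable ?N c"
    proof (rule ext_integral_less_infinity_imp_integrable)
      show "c \<in> borel_measurable ?N" by simp
      show "integrable ?N (\<lambda>_. 0 :: real)" by simp
      show "0 \<le> c s" if "s \<in> space ?N" for s using that c_nonneg by simp
      show "ext_integral ?N c < \<infinity>" using fin by (simp add: obj_A_def)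
    qed
    then show "integrable P (\<lambda>s. c s * h s)" by (simp add: eq)
  qed (simp add: val)
qed

lemma RN_deriv_density:
  assumes "h \<in> densities"
  shows "AE s in P. RN_deriv P (density P (\<lambda>s. ennreal (h s))) s = ennreal (h s)"
proof -
  have "AE s in P. ennreal (h s) = RN_deriv P (density P (\<lambda>s. ennreal (h s))) s"
    using densitiesD(1)[OF assms] by (intro P.RN_deriv_unique) auto
  then show ?thesis by eventually_elim simp
qed

text \<open>A primal feasible measure is determined by a density bounded by \<open>\<phi>\<close> at every point, since the
  Radon-Nikodym derivative can be changed on a null set.\<close>

lemma bounded_RN_deriv_imp_density:
  assumes sets: "sets \<nu> = sets P" and ac: "absolutely_continuous P \<nu>"
    and le: "AE s in P. RN_deriv P \<nu> s \<le> ennreal (\<phi> s)"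
    and marg: "\<And>t. t \<le> T \<Longrightarrow> distr \<nu> (m t) (\<lambda>s. s t) = m t"
  obtains h where "h \<in> densities" "\<nu> = density P (\<lambda>s. ennreal (h s))"
proof -
  define h where "h s = min (\<phi> s) (enn2real (RN_deriv P \<nu> s))" for s
  have hm: "h \<in> borel_measurable P" unfolding h_def[abs_def] by measurable
  have h0: "0 \<le> h s" if "s \<in> space P" for s using phi_nonneg[OF that] by (simp add: h_def)
  have h1: "h s \<le> \<phi> s" for s by (simp add: h_def)
  have "AE s in P. RN_deriv P \<nu> s = ennreal (h s)"
    using le AE_space
  proof eventually_elim
    case (elim s)
    then have "RN_deriv P \<nu> s < \<infinity>" by (auto intro: le_less_trans)
    then obtain r where r: "0 \<le> r" "RN_deriv P \<nu> s = ennreal r" by (cases "RN_deriv P \<nu> s") auto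
    with elim(1) phi_nonneg[OF elim(2)] show ?case by (simp add: h_def min_absorb2)
  qed
  then have "density P (RN_deriv P \<nu>) = density P (\<lambda>s. ennreal (h s))"
    using hm by (intro density_cong) auto
  with P.density_RN_deriv[OF ac sets] have \<nu>: "\<nu> = density P (\<lambda>s. ennreal (h s))" by simp
  have hint: "integrable P h"
    by (rule integrable_between[OF hm _ phi_int, of "\<lambda>_. 0"]) (use h0 h1 in auto)
  have "h \<in> densities"
  proof (rule densitiesI)
    fix t A assume t: "t \<le> T" and A: "A \<in> sets (m t)"
    show "(\<integral>s. h s * indicator A (s t) \<partial>P) = measure (m t) A"
      using marginals_iff_distr[OF hint h0 t] marg[OF t] A unfolding \<nu> by blast
  qed (use hm h0 h1 in auto)
  then show ?thesis using that \<nu> by blast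
qed

end

lemma min_value_eq_INF:
  fixes J :: "'b \<Rightarrow> ereal"
  assumes "z \<in> C" "\<And>z'. z' \<in> C \<Longrightarrow> J z \<le> J z'"
  shows "(INF z'\<in>C. J z') = J z"
  using assms by (intro antisym INF_lower INF_greatest)

section \<open>Duality for the capacity-constrained transport problem\<close>

theorem theorem22:
  fixes T :: nat
    and X :: "nat \<Rightarrow> 'a topology"
    and \<psi> :: "nat \<Rightarrow> 'a \<Rightarrow> real"
    and m :: "nat \<Rightarrow> 'a measure"
    and \<mu> :: "(nat \<Rightarrow> 'a) measure"
    and c \<phi> :: "(nat \<Rightarrow> 'a) \<Rightarrow> real"
    and K v :: real
  assumes polish: "\<And>t. t \<le> T \<Longrightarrow> polish (X t)"
    and psi_cont: "\<And>t. t \<le> T \<Longrightarrow> continuous_map (X t) euclideanreal (\<psi> t)"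
    and psi_ge_1: "\<And>t s. t \<le> T \<Longrightarrow> s \<in> topspace (X t) \<Longrightarrow> 1 \<le> \<psi> t s"
    and m_in_M: "\<And>t. t \<le> T \<Longrightarrow> m t \<in> M_plus (X t) (\<psi> t)"
    and m_prob: "\<And>t. t \<le> T \<Longrightarrow> prob_space (m t)"
    and mu: "\<mu> = PiM {..T} m"
    and c_meas: "c \<in> borel_measurable (borel_of (product_top T X))"
    and phi_meas: "\<phi> \<in> borel_measurable (borel_of (product_top T X))"
    and c_nonneg: "\<And>s. s \<in> topspace (product_top T X) \<Longrightarrow> 0 \<le> c s"
    and phi_nonneg: "\<And>s. s \<in> topspace (product_top T X) \<Longrightarrow> 0 \<le> \<phi> s"
    and c_int: "integrable \<mu> c"
    and phi_int: "integrable \<mu> \<phi>"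
    and c_ge: "\<And>s. s \<in> topspace (product_top T X) \<Longrightarrow> K * coord_sum T \<psi> s \<le> c s"
    and v_gt_1: "1 < v"
    and phi_ge: "\<And>s. s \<in> topspace (product_top T X) \<Longrightarrow> v \<le> \<phi> s"
  shows
    "(\<exists>\<nu>. optimal (constr_A T X \<psi> m \<mu> \<phi>) (obj_A c) \<nu>) \<and>
     (\<exists>x. optimal (constr_B T X) (obj_B T \<mu> c \<phi>) x) \<and>
     (INF x\<in>constr_B T X. obj_B T \<mu> c \<phi> x) =
       - (INF \<nu>\<in>constr_A T X \<psi> m \<mu> \<phi>. obj_A c \<nu>) \<and>
     (\<forall>\<nu> x.
        feasible (constr_A T X \<psi> m \<mu> \<phi>) (obj_A c) \<nu> \<longrightarrow>
        feasible (constr_B T X) (obj_B T \<mu> c \<phi>) x \<longrightarrow>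
        (optimal (constr_A T X \<psi> m \<mu> \<phi>) (obj_A c) \<nu> \<and>
         optimal (constr_B T X) (obj_B T \<mu> c \<phi>) x \<longleftrightarrow>
         (AE s in \<mu>.
            (- coord_sum T x s < c s \<longrightarrow> RN_deriv \<mu> \<nu> s = 0) \<and>
            (- coord_sum T x s = c s \<longrightarrow> RN_deriv \<mu> \<nu> s \<in> {0..ennreal (\<phi> s)}) \<and>
            (- coord_sum T x s > c s \<longrightarrow> RN_deriv \<mu> \<nu> s = ennreal (\<phi> s))))) \<and>
     (\<forall>x. feasible (constr_B T X) (obj_B T \<mu> c \<phi>) x \<longrightarrow> (\<forall>t\<le>T. x t \<in> L1 (m t)))"
proof -
  let ?A = "constr_A T X \<psi> m \<mu> \<phi>" and ?B = "constr_B T X" and ?JB = "obj_B T \<mu> c \<phi>"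
  have sets_m: "sets (m t) = sets (borel_of (X t))" if "t \<le> T" for t
    using m_in_M[OF that] by (simp add: M_plus_def)
  have sets_P: "sets (PiM {..T} m) = sets (borel_of (product_top T X))"
  proof -
    have "sets (PiM {..T} m) = sets (PiM {..T} (\<lambda>t. borel_of (X t)))"
      by (rule sets_PiM_cong) (simp_all add: sets_m)
    also have "\<dots> = sets (borel_of (product_top T X))"
      by (rule sets_borel_of_product_top[symmetric]) (rule polish)
    finally show ?thesis .
  qed
  have space_P: "space (PiM {..T} m) = topspace (product_top T X)"
    using sets_eq_imp_space_eq[OF sets_P] by simp
  interpret capacity_transport T m c \<phi> v
  proof (rule capacity_transport.intro[OF product_of_prob_spaces.intro capacity_transport_axioms.intro])
    show "prob_space (m t)" if "t \<le> T" for t using that by (rule m_prob)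
    show "integrable (PiM {..T} m) c" "integrable (PiM {..T} m) \<phi>"
      using c_int phi_int by (simp_all only: mu)
    show "0 \<le> c s" "v \<le> \<phi> s" if "s \<in> space (PiM {..T} m)" for s
      using that c_nonneg phi_ge by (simp_all only: space_P)
  qed (rule v_gt_1)
  have B_iff: "x \<in> ?B \<longleftrightarrow> (\<forall>t\<le>T. x t \<in> borel_measurable (m t))" for x
    unfolding constr_B_def using measurable_cong_sets[OF sets_m refl] by (auto simp: Pi_iff)
  \<comment> \<open>the primal constraint set consists exactly of the measures with a density in \<open>densities\<close>\<close>
  have A_density: "density P (\<lambda>s. ennreal (h s)) \<in> ?A" if h: "h \<in> densities" for h
  proof -
    let ?N = "density P (\<lambda>s. ennreal (h s))"
    have hm [measurable]: "h \<in> borel_measurable P" by (rule densitiesD(1)[OF h])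
    have hAE: "AE s in P. 0 \<le> h s" using densitiesD(2)[OF h] by (intro AE_I2)
    have "emeasure ?N (space ?N) = (\<integral>\<^sup>+s. ennreal (h s) \<partial>P)"
      by (auto simp: emeasure_density intro!: nn_integral_cong)
    also have "\<dots> = ennreal (\<integral>s. h s \<partial>P)"
      using densities_integrable[OF h] hAE by (rule nn_integral_eq_integral)
    finally have "finite_measure ?N" by (intro finite_measureI) simp
    moreover have "integrable ?N (coord_sum T \<psi>)"
      unfolding coord_sum_def
    proof (rule Bochner_Integration.integrable_sum)
      fix t assume "t \<in> {..T}"
      then have t: "t \<le> T" by simp
      have \<psi>: "integrable (m t) (\<psi> t)" using m_in_M[OF t] by (simp add: M_plus_def)
      then have "\<psi> t \<in> borel_measurable (m t)" by auto
      then have "(\<lambda>s. \<psi> t (s t)) \<in> borel_measurable P"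
        by (rule measurable_compose[OF measurable_coordinate[OF t]])
      then show "integrable ?N (\<lambda>s. \<psi> t (s t))"
        using density_integral_coordinate(1)[OF h t \<psi>] integrable_real_density[OF hm hAE] by simp
    qed
    moreover have "absolutely_continuous P ?N"
      by (rule absolutely_continuousI_density) simp
    moreover have "AE s in P. RN_deriv P ?N s \<le> ennreal (\<phi> s)"
      using RN_deriv_density[OF h] AE_space
      by eventually_elim (simp add: ennreal_leI densitiesD(3)[OF h])
    moreover have "distr ?N (borel_of (X t)) (\<lambda>s. s t) = m t" if t: "t \<le> T" for t
    proof -
      have "distr ?N (borel_of (X t)) (\<lambda>s. s t) = distr ?N (m t) (\<lambda>s. s t)"
        by (rule distr_cong) (simp_all add: sets_m[OF t])
      then show ?thesis using densities_distr[OF h t] by simp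
    qed
    ultimately show ?thesis by (simp add: constr_A_def M_plus_def mu sets_P)
  qed
  have A_D: "\<exists>h\<in>densities. \<nu> = density P (\<lambda>s. ennreal (h s))" if \<nu>: "\<nu> \<in> ?A" for \<nu>
  proof -
    have marg: "distr \<nu> (m t) (\<lambda>s. s t) = m t" if t: "t \<le> T" for t
    proof -
      have "distr \<nu> (m t) (\<lambda>s. s t) = distr \<nu> (borel_of (X t)) (\<lambda>s. s t)"
        by (rule distr_cong) (simp_all add: sets_m[OF t])
      then show ?thesis using \<nu> t by (simp add: constr_A_def)
    qed
    have "sets \<nu> = sets P" "absolutely_continuous P \<nu>" "AE s in P. RN_deriv P \<nu> s \<le> ennreal (\<phi> s)"
      using \<nu> by (auto simp: constr_A_def M_plus_def mu sets_P)
    from bounded_RN_deriv_imp_density[OF this marg] show ?thesis by blast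
  qed
  have gap_integral: "0 \<le> (\<integral>s. slackness_gap z h s \<partial>P)" if "h \<in> densities" for z h
    by (intro integral_nonneg_AE AE_I2 slackness_gap_nonneg that)
  obtain z0 h0 where z0: "z0 \<in> potentials" and h0: "h0 \<in> densities" and ch0: "integrable P (\<lambda>s. c s * h0 s)"
    and eq0: "dual_value neg_part z0 = - (\<integral>s. c s * h0 s \<partial>P)"
    using strong_duality by blast
  obtain x0 where x0: "\<And>t. t \<le> T \<Longrightarrow> x0 t \<in> borel_measurable (m t)" "z0 = coord_sum T x0"
    using z0 by (auto simp: potentials_def)
  define \<nu>0 where "\<nu>0 = density P (\<lambda>s. ennreal (h0 s))"
  define d where "d = dual_value neg_part z0"
  have x0B: "x0 \<in> ?B" using x0 by (simp add: B_iff)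
  have Jx0: "?JB x0 = ereal d" using obj_B_potential z0 x0(2) by (simp add: d_def mu)
  have \<nu>0A: "\<nu>0 \<in> ?A" unfolding \<nu>0_def by (rule A_density[OF h0])
  have J\<nu>0: "obj_A c \<nu>0 = ereal (- d)" unfolding \<nu>0_def using obj_A_density(1)[OF h0 ch0] eq0 by (simp add: d_def)
  have B_ge: "ereal d \<le> ?JB x" if x: "x \<in> ?B" for x
  proof (cases "?JB x < \<infinity>")
    case True
    then have z: "coord_sum T x \<in> potentials" using obj_B_less_infinity_iff x by (simp add: B_iff mu)
    show ?thesis
      using weak_duality(2)[OF z h0 ch0] gap_integral[OF h0, of "coord_sum T x"] eq0 obj_B_potential[OF z]
      by (simp add: d_def mu)
  qed auto
  have A_ge: "ereal (- d) \<le> obj_A c \<nu>" if \<nu>: "\<nu> \<in> ?A" for \<nu>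
  proof (cases "obj_A c \<nu> < \<infinity>")
    case True
    obtain h where h: "h \<in> densities" "\<nu> = density P (\<lambda>s. ennreal (h s))" using A_D[OF \<nu>] by blast
    then have ch: "integrable P (\<lambda>s. c s * h s)" using True obj_A_density(2) by simp
    then show ?thesis
      using weak_duality(2)[OF z0 h(1) ch] gap_integral[OF h(1), of z0] obj_A_density(1)[OF h(1) ch] h(2)
      by (simp add: d_def)
  qed auto
  have opt_A: "optimal ?A (obj_A c) \<nu> \<longleftrightarrow> obj_A c \<nu> = ereal (- d)" if \<nu>: "\<nu> \<in> ?A" for \<nu>
  proof
    assume "optimal ?A (obj_A c) \<nu>"
    then have "obj_A c \<nu> \<le> obj_A c \<nu>0" using \<nu>0A by (simp add: optimal_iff)
    then show "obj_A c \<nu> = ereal (- d)" using A_ge[OF \<nu>] by (intro antisym) (simp_all add: J\<nu>0)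
  qed (use \<nu> A_ge in \<open>simp add: optimal_iff feasible_def\<close>)
  have opt_B: "optimal ?B ?JB x \<longleftrightarrow> ?JB x = ereal d" if x: "x \<in> ?B" for x
  proof
    assume "optimal ?B ?JB x"
    then have "?JB x \<le> ?JB x0" using x0B by (simp add: optimal_iff)
    then show "?JB x = ereal d" using B_ge[OF x] by (intro antisym) (simp_all add: Jx0)
  qed (use x B_ge in \<open>simp add: optimal_iff feasible_def\<close>)
  have inf_B: "(INF x\<in>?B. ?JB x) = ereal d"
    using min_value_eq_INF[OF x0B, of ?JB] B_ge Jx0 by simp
  have inf_A: "(INF \<nu>\<in>?A. obj_A c \<nu>) = ereal (- d)"
    using min_value_eq_INF[OF \<nu>0A, of "obj_A c"] A_ge J\<nu>0 by simp
  have slackness: "optimal ?A (obj_A c) \<nu> \<and> optimal ?B ?JB x \<longleftrightarrow>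
         (AE s in \<mu>.
            (- coord_sum T x s < c s \<longrightarrow> RN_deriv \<mu> \<nu> s = 0) \<and>
            (- coord_sum T x s = c s \<longrightarrow> RN_deriv \<mu> \<nu> s \<in> {0..ennreal (\<phi> s)}) \<and>
            (- coord_sum T x s > c s \<longrightarrow> RN_deriv \<mu> \<nu> s = ennreal (\<phi> s)))" (is "_ \<longleftrightarrow> ?cs")
    if \<nu>: "feasible ?A (obj_A c) \<nu>" and x: "feasible ?B ?JB x" for \<nu> x
  proof -
    have \<nu>A: "\<nu> \<in> ?A" and xB: "x \<in> ?B" using \<nu> x by (auto simp: feasible_def)
    obtain h where h: "h \<in> densities" "\<nu> = density P (\<lambda>s. ennreal (h s))" using A_D[OF \<nu>A] by blast
    have ch: "integrable P (\<lambda>s. c s * h s)" using \<nu> obj_A_density(2)[OF h(1)] h(2) by (simp add: feasible_def)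
    define z where "z = coord_sum T x"
    have z: "z \<in> potentials"
      using x obj_B_less_infinity_iff[of x] xB by (simp add: feasible_def B_iff mu z_def)
    have J\<nu>: "obj_A c \<nu> = ereal (\<integral>s. c s * h s \<partial>P)" using obj_A_density(1)[OF h(1) ch] h(2) by simp
    have Jx: "?JB x = ereal (dual_value neg_part z)" using obj_B_potential z by (simp add: mu z_def)
    have "optimal ?A (obj_A c) \<nu> \<and> optimal ?B ?JB x \<longleftrightarrow> dual_value neg_part z + (\<integral>s. c s * h s \<partial>P) = 0"
      using A_ge[OF \<nu>A] B_ge[OF xB] unfolding opt_A[OF \<nu>A] opt_B[OF xB] J\<nu> Jx by auto
    also have "\<dots> \<longleftrightarrow> (AE s in P. slackness_gap z h s = 0)"
      unfolding weak_duality(2)[OF z h(1) ch]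
      by (intro integral_nonneg_eq_0_iff_AE weak_duality(1)[OF z h(1) ch] AE_I2 slackness_gap_nonneg[OF h(1)])
    also have "\<dots> \<longleftrightarrow> (AE s in P.
        (- z s < c s \<longrightarrow> RN_deriv P \<nu> s = 0) \<and>
        (- z s = c s \<longrightarrow> RN_deriv P \<nu> s \<in> {0..ennreal (\<phi> s)}) \<and>
        (- z s > c s \<longrightarrow> RN_deriv P \<nu> s = ennreal (\<phi> s)))"
    proof (rule eventually_subst, use RN_deriv_density[OF h(1)] AE_space in eventually_elim)
      case (elim s)
      then show ?case
        using densitiesD(2,3)[OF h(1) elim(2)]
        unfolding h(2) slackness_gap_eq_0_iff[OF h(1) elim(2)]
        by (auto simp: ennreal_leI)
    qed
    finally show ?thesis by (simp only: mu z_def)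
  qed
  have summands: "x t \<in> L1 (m t)" if "feasible ?B ?JB x" "t \<le> T" for x t
  proof -
    have xm: "t \<le> T \<Longrightarrow> x t \<in> borel_measurable (m t)" for t
      using that by (simp add: feasible_def B_iff)
    have "coord_sum T x \<in> potentials"
      using that obj_B_less_infinity_iff[OF xm] by (simp add: feasible_def mu)
    from potentials_integrable_summands[OF xm this that(2)] show ?thesis by simp
  qed
  show ?thesis
  proof (intro conjI allI impI)
    show "\<exists>\<nu>. optimal ?A (obj_A c) \<nu>" using opt_A[OF \<nu>0A] J\<nu>0 by blast
    show "\<exists>x. optimal ?B ?JB x" using opt_B[OF x0B] Jx0 by blast
    show "(INF x\<in>?B. ?JB x) = - (INF \<nu>\<in>?A. obj_A c \<nu>)" by (simp add: inf_A inf_B)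
  qed (rule slackness summands; assumption)+
qed

end
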